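(* Let $\mu,\nu$ be probability measures on $\mathcal{X}$ with $\mu \ll \nu$, and suppose the partially observed Markov process is observable (i.e. $N$ step observable for some finite $N\in\mathbb{N}$). Then the one step predictors $\pi_{n-}^{\mu}$ and $\pi_{n-}^{\nu}$ merge weakly $P^{\mu}$-almost surely: there is an event of $P^{\mu}$-probability one on which, for every $f \in C_b(\mathcal{X})$, $\lim_{n\to\infty}\left|\int f\,d\pi_{n-}^{\mu}-\int f\,d\pi_{n-}^{\nu}\right| = 0$.
   Context: Setting: $\mathcal{X},\mathcal{Y},\mathcal{Z}$ are Polish spaces with Borel $\sigma$-fields. $T$ is a transition kernel on $\mathcal{X}$; $\{Z_n\}_{n\ge 0}$ is an i.i.d. $\mathcal{Z}$-valued sequence with law $Q$, independent of the state process; $h:\mathcal{X}\times\mathcal{Z}\to\mathcal{Y}$ is measurable. The state process $\{X_n\}$ is a Markov chain with transition kernel $T$ and initial law $X_0\sim\mu$, and the observations are $Y_n=h(X_n,Z_n)$. $P^{\mu}$ denotes the law of $\{(X_n,Y_n)\}_{n\ge0}$ on $(\mathcal{X}\times\mathcal{Y})^{\mathbb{Z}_+}$ when $X_0\sim\mu$, and $E^\mu$ its expectation. The one step predictor is $\pi_{n-}^{\mu}(\cdot)=P^{\mu}(X_n\in\cdot\mid Y_0,\dots,Y_{n-1})$ and the filter is $\pi_n^{\mu}(\cdot)=P^{\mu}(X_n\in\cdot\mid Y_0,\dots,Y_n)$. $C_b(\mathcal{X})$ is the set of bounded continuous real functions on $\mathcal{X}$. For $N\in\mathbb{N}$, let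 $P(dy_{[1,N]}\mid X_1=x)$ denote the conditional law of $(Y_1,\dots,Y_N)$ given $X_1=x$ (which does not depend on the prior). The model is $N$ step observable if for every $f\in C_b(\mathcal{X})$ and $\epsilon>0$ there is a bounded measurable $g:\mathcal{Y}^N\to\mathbb{R}$ with $\sup_{x\in\mathcal{X}}\left|f(x)-\int_{\mathcal{Y}^N} g(y_{[1,N]})P(dy_{[1,N]}\mid X_1=x)\right|<\epsilon$; it is observable if it is $N$ step observable for some finite $N$. *)

theory Defs
  imports "HOL-Probability.Probability"
begin

fun path_law :: "('x::topological_space \<Rightarrow> 'x measure) \<Rightarrow> 'x measure \<Rightarrow> nat \<Rightarrow> (nat \<Rightarrow> 'x) measure" where
  "path_law T \<mu> 0 = distr \<mu> (PiM {..0} (\<lambda>_. borel)) (\<lambda>x. \<lambda>i\<in>{..0}. x)"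
| "path_law T \<mu> (Suc n) =
     path_law T \<mu> n \<bind> (\<lambda>p. distr (T (p n)) (PiM {..Suc n} (\<lambda>_. borel)) (\<lambda>x. p(Suc n := x)))"

definition xz_law :: "('x::topological_space \<Rightarrow> 'x measure) \<Rightarrow> 'z measure \<Rightarrow> 'x measure \<Rightarrow> nat
    \<Rightarrow> ((nat \<Rightarrow> 'x) \<times> (nat \<Rightarrow> 'z)) measure" where
  "xz_law T Q \<mu> n = path_law T \<mu> n \<Otimes>\<^sub>M PiM {..n} (\<lambda>_. Q)"

definition obs_vec :: "('x \<times> 'z \<Rightarrow> 'y) \<Rightarrow> nat \<Rightarrow> (nat \<Rightarrow> 'x) \<times> (nat \<Rightarrow> 'z) \<Rightarrow> (nat \<Rightarrow> 'y)" where
  "obs_vec h n p = (\<lambda>i\<in>{..<n}. h (fst p i, snd p i))"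

text \<open>kappa is a (version of the) one step predictor P^mu(X_n \<in> . | Y_0,...,Y_{n-1}),
i.e. a regular conditional distribution of X_n given (Y_0,...,Y_{n-1}) under P^mu.\<close>
definition is_predictor :: "('x::topological_space \<Rightarrow> 'x measure) \<Rightarrow> 'z measure \<Rightarrow> ('x \<times> 'z \<Rightarrow> 'y::topological_space)
    \<Rightarrow> 'x measure \<Rightarrow> nat \<Rightarrow> ((nat \<Rightarrow> 'y) \<Rightarrow> 'x measure) \<Rightarrow> bool" where
  "is_predictor T Q h \<mu> n \<kappa> \<longleftrightarrow>
     \<kappa> \<in> PiM {..<n} (\<lambda>_. borel) \<rightarrow>\<^sub>M prob_algebra borel \<and>
     (\<forall>A\<in>sets borel. \<forall>B\<in>sets (PiM {..<n} (\<lambda>_. borel)).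
        measure (xz_law T Q \<mu> n) {p \<in> space (xz_law T Q \<mu> n). fst p n \<in> A \<and> obs_vec h n p \<in> B}
        = (\<integral>p. indicator B (obs_vec h n p) * measure (\<kappa> (obs_vec h n p)) A \<partial>xz_law T Q \<mu> n))"

text \<open>Conditional law of (Y_1,...,Y_N) given X_1 = x (indices 1..N); by time homogeneity
it is the law of the observations at times 1..N of the chain started at time 1 in x.\<close>
definition obs_law :: "('x::topological_space \<Rightarrow> 'x measure) \<Rightarrow> 'z measure \<Rightarrow> ('x \<times> 'z \<Rightarrow> 'y::topological_space)
    \<Rightarrow> 'x \<Rightarrow> nat \<Rightarrow> (nat \<Rightarrow> 'y) measure" where
  "obs_law T Q h x N = distr (xz_law T Q (return borel x) (N - 1)) (PiM {1..N} (\<lambda>_. borel))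
      (\<lambda>p. \<lambda>i\<in>{1..N}. h (fst p (i - 1), snd p (i - 1)))"

definition N_step_observable :: "('x::topological_space \<Rightarrow> 'x measure) \<Rightarrow> 'z measure \<Rightarrow> ('x \<times> 'z \<Rightarrow> 'y::topological_space)
    \<Rightarrow> nat \<Rightarrow> bool" where
  "N_step_observable T Q h N \<longleftrightarrow>
     (\<forall>f :: 'x \<Rightarrow> real. continuous_on UNIV f \<and> bounded (range f) \<longrightarrow>
       (\<forall>\<epsilon>>0. \<exists>g :: (nat \<Rightarrow> 'y) \<Rightarrow> real.
          g \<in> borel_measurable (PiM {1..N} (\<lambda>_. borel)) \<and>
          bounded (g ` space (PiM {1..N} (\<lambda>_. borel :: 'y measure))) \<and>
          (SUP x. \<bar>f x - (\<integral>y. g y \<partial>obs_law T Q h x N)\<bar>) < \<epsilon>))"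

definition observable where
  "observable T Q h \<longleftrightarrow> (\<exists>N>0. N_step_observable T Q h N)"

end

theory Submission
  imports Defs
begin

text \<open>
  Fix \<open>N\<close> and let \<open>L n\<close> be the likelihood ratio of \<open>(Y\<^sub>0, \<dots>, Y\<^sub>n\<^sub>-\<^sub>1)\<close> under the priors \<open>\<mu>\<close> and \<open>\<nu>\<close>. Given the
  first \<open>n\<close> observations, the conditional law of the next \<open>N\<close> ones under \<open>\<mu>\<close> has density \<open>L (n + N) / L n\<close>
  with respect to the one under \<open>\<nu>\<close>. The convex function \<open>1 / (1 + x)\<close> turns the \<open>\<nu>\<close>-martingale \<open>L\<close> into a bounded
  submartingale; its conditional \<open>N\<close>-step increments have summable expectations, hence tend to \<open>0\<close>, and
  they control the conditional expectation of \<open>\<bar>L (n + N) - L n\<bar>\<close>. A maximal inequality keeps \<open>L n\<close> away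
  from \<open>0\<close> and, by \<open>\<mu> \<lless> \<nu>\<close>, from infinity, \<open>\<mu>\<close>-almost surely. So the conditional laws of the next \<open>N\<close>
  observations merge in total variation (Blackwell and Dubins). As this happens on a single almost sure
  event for all bounded test functions at once, observability transfers it to every bounded continuous
  function of the state. Only finite-dimensional laws are used, so no path space under \<open>\<nu>\<close> is needed.
\<close>

section \<open>Densities and kernels\<close>

text \<open>The process is realised under \<mu> only, so the drift estimate under \<nu> has to be
  carried over. The change of measure costs a factor \<open>LR n\<close>, which the weight
  \<open>1 / (1 + LR n)\<close> absorbs; this is why the summable quantity is \<open>gap\<close>
  divided by \<open>1 + LR\<close>. The function \<open>1 / (1 + x)\<close> is convenient because
  its second order remainder at \<open>a\<close> is explicit, namely
  \<open>(b - a)^2 / ((1 + a)^2 * (1 + b))\<close>. The weight \<open>1 / (1 + b)\<close> tames the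
  square, so only first moments of the likelihood ratio occur, and a Cauchy-Schwarz argument
  recovers the mean of \<open>\<bar>b - a\<bar>\<close>. The upper bound on \<open>LR\<close> is
  where the priors must be compared quantitatively: the maximal inequality bounds the
  \<nu>-probability of a large ratio up to time \<open>m\<close>. The probability of an observation
  event is the mean over the prior of its probability given the initial state, so the uniform form
  of absolute continuity yields a \<mu>-bound with the same constant for all
  \<open>m\<close>.\<close>

lemma borel_countable_Int_stable_generator:
  obtains G :: "'w::second_countable_topology set set" where
    "countable G" "Int_stable G" "UNIV \<in> G" "sets borel = sigma_sets UNIV G"
proof -
  obtain B :: "'w set set" where B: "countable B" "topological_basis B"
    using ex_countable_basis by blast
  \<comment> \<open>Closing a countable basis under finite intersections keeps it countable, so that
    almost sure statements can be collected over it, and makes it a pi-system, on which finite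
    measures are determined. The empty intersection supplies \<open>UNIV\<close>.\<close>
  define G where "G = Inter ` {b. finite b \<and> b \<subseteq> B}"
  have sB: "sets borel = sigma_sets UNIV B"
    unfolding borel_eq_countable_basis[OF B] by simp
  have "countable G"
    unfolding G_def by (intro countable_image countable_Collect_finite_subset B)
  moreover have "Int_stable G"
    unfolding Int_stable_def G_def
  proof clarify
    fix a b assume "finite a" "a \<subseteq> B" "finite b" "b \<subseteq> B"
    then show "\<Inter> a \<inter> \<Inter> b \<in> Inter ` {b. finite b \<and> b \<subseteq> B}"
      by (intro image_eqI[of _ _ "a \<union> b"]) auto
  qed
  moreover have "UNIV \<in> G"
    unfolding G_def by (intro image_eqI[of _ _ "{}"]) auto
  moreover have "sets borel = sigma_sets UNIV G"
  proof
    have "B \<subseteq> G"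
    proof
      fix b assume "b \<in> B"
      then show "b \<in> G" unfolding G_def by (intro image_eqI[of _ _ "{b}"]) auto
    qed
    then show "sets borel \<subseteq> sigma_sets UNIV G"
      unfolding sB by (rule sigma_sets_mono')
    have "G \<subseteq> sets (borel :: 'w measure)"
    proof
      fix g assume "g \<in> G"
      then obtain b where b: "finite b" "b \<subseteq> B" "g = \<Inter> b" unfolding G_def by auto
      have "b \<subseteq> sets borel" using b topological_basis_open[OF B(2)] by (auto intro: borel_open)
      then show "g \<in> sets borel"
        using b(1) unfolding b(3) using sets.finite_INT[of b "\<lambda>x. x" borel] by (cases "b = {}") auto
    qed
    then show "sigma_sets UNIV G \<subseteq> sets borel"
      using sets.sigma_sets_subset[of G borel] by simp
  qed
  ultimately show ?thesis by (rule that)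
qed

text \<open>By second countability the exceptional null set does not depend on
  the test set.\<close>

lemma AE_kernel_eq_density:
  fixes G G' :: "'a \<Rightarrow> 'w::second_countable_topology measure" and L :: "'a \<Rightarrow> real" and R :: "'a \<Rightarrow> 'w \<Rightarrow> real"
  assumes M: "finite_measure M"
    and G [measurable]: "G \<in> M \<rightarrow>\<^sub>M prob_algebra borel" and G' [measurable]: "G' \<in> M \<rightarrow>\<^sub>M prob_algebra borel"
    and L [measurable]: "L \<in> borel_measurable M" and L_nonneg: "\<And>y. 0 \<le> L y"
    and R [measurable]: "(\<lambda>(y, w). R y w) \<in> borel_measurable (M \<Otimes>\<^sub>M borel)" and R_nonneg: "\<And>y w. 0 \<le> R y w"
    and eq: "\<And>A B. A \<in> sets borel \<Longrightarrow> B \<in> sets M \<Longrightarrow>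
      (\<integral>\<^sup>+y. indicator B y * (\<integral>\<^sup>+w. indicator A w \<partial>G y) * ennreal (L y) \<partial>M) =
      (\<integral>\<^sup>+y. \<integral>\<^sup>+w. indicator B y * indicator A w * ennreal (R y w) \<partial>G' y \<partial>M)"
  shows "AE y in M. (\<integral>\<^sup>+w. ennreal (R y w) \<partial>G' y) = ennreal (L y)"
    and "AE y in M. 0 < L y \<longrightarrow> G y = density (G' y) (\<lambda>w. ennreal (R y w / L y))"
proof -
  interpret finite_measure M by fact
  note [measurable] = measurable_prob_algebraD[OF G] measurable_prob_algebraD[OF G']
  have G_sp: "sets (G y) = sets borel" "prob_space (G y)" "sets (G' y) = sets borel" "prob_space (G' y)"
    if "y \<in> space M" for y
    using measurable_space[OF G that] measurable_space[OF G' that] by (auto simp: space_prob_algebra)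
  have R_y: "(\<lambda>w. R y w) \<in> borel_measurable (G' y)" if "y \<in> space M" for y
    using measurable_Pair2[OF R that] by (simp add: G_sp[OF that] cong: measurable_cong_sets)
  \<comment> \<open>For fixed \<open>A\<close>, \<open>eq\<close> says that both functions of
    \<open>y\<close> have the same integral over every measurable \<open>B\<close>, so as densities
    with respect to \<open>M\<close> they agree almost everywhere.\<close>
  have *: "AE y in M. (\<integral>\<^sup>+w. indicator A w \<partial>G y) * ennreal (L y) = (\<integral>\<^sup>+w. indicator A w * ennreal (R y w) \<partial>G' y)"
    if A [measurable]: "A \<in> sets borel" for A
  proof (rule density_unique_finite_measure)
    show "(\<lambda>y. (\<integral>\<^sup>+w. indicator A w \<partial>G y) * ennreal (L y)) \<in> borel_measurable M"
      by measurable
    show "(\<lambda>y. \<integral>\<^sup>+w. indicator A w * ennreal (R y w) \<partial>G' y) \<in> borel_measurable M"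
      by (intro nn_integral_measurable_subprob_algebra2[where N = borel]) measurable
    fix B assume B: "B \<in> sets M"
    have "(\<integral>\<^sup>+y. \<integral>\<^sup>+w. indicator B y * indicator A w * ennreal (R y w) \<partial>G' y \<partial>M) =
        (\<integral>\<^sup>+y. (\<integral>\<^sup>+w. indicator A w * ennreal (R y w) \<partial>G' y) * indicator B y \<partial>M)"
      by (intro nn_integral_cong) (auto split: split_indicator)
    with eq[OF A B] show "(\<integral>\<^sup>+y. (\<integral>\<^sup>+w. indicator A w \<partial>G y) * ennreal (L y) * indicator B y \<partial>M) =
        (\<integral>\<^sup>+y. (\<integral>\<^sup>+w. indicator A w * ennreal (R y w) \<partial>G' y) * indicator B y \<partial>M)"
      by (simp add: mult_ac)
  qed auto
  show "AE y in M. (\<integral>\<^sup>+w. ennreal (R y w) \<partial>G' y) = ennreal (L y)"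
    using *[OF space_in_borel] AE_space
  proof eventually_elim
    case (elim y)
    then show ?case using prob_space.emeasure_space_1[OF G_sp(2)] by simp
  qed
  obtain H :: "'w set set" where H: "countable H" "Int_stable H" "UNIV \<in> H" "sets borel = sigma_sets UNIV H"
    by (rule borel_countable_Int_stable_generator)
  have H_borel: "A \<in> sets borel" if "A \<in> H" for A
    using that H(4) by auto
  have "AE y in M. \<forall>A\<in>H. (\<integral>\<^sup>+w. indicator A w \<partial>G y) * ennreal (L y) = (\<integral>\<^sup>+w. indicator A w * ennreal (R y w) \<partial>G' y)"
    using H(1) * H_borel by (subst AE_ball_countable) blast+
  then show "AE y in M. 0 < L y \<longrightarrow> G y = density (G' y) (\<lambda>w. ennreal (R y w / L y))"
    using AE_space
  proof eventually_elim
    case (elim y)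
    note [simp] = G_sp[OF elim(2)] and [measurable] = R_y[OF elim(2)]
    show ?case
    proof
      assume Ly: "0 < L y"
      show "G y = density (G' y) (\<lambda>w. ennreal (R y w / L y))"
      proof (rule measure_eqI_generator_eq_countable[OF H(2), of UNIV _ _ "{UNIV}"])
        fix A assume "A \<in> H"
        then have A[measurable]: "A \<in> sets borel" by (rule H_borel)
        then have [simp]: "A \<in> sets (G' y)" "A \<in> sets (G y)" by simp_all
        have "emeasure (density (G' y) (\<lambda>w. ennreal (R y w / L y))) A =
           (\<integral>\<^sup>+w. ennreal (1 / L y) * (indicator A w * ennreal (R y w)) \<partial>G' y)"
          using Ly R_nonneg by (subst emeasure_density)
            (auto intro!: nn_integral_cong simp: ennreal_mult'[symmetric] split: split_indicator)
        also have "\<dots> = ennreal (1 / L y) * (emeasure (G y) A * ennreal (L y))"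
        proof (subst nn_integral_cmult)
          show "(\<lambda>w. indicator A w * ennreal (R y w)) \<in> borel_measurable (G' y)"
            by (intro borel_measurable_times_ennreal borel_measurable_indicator measurable_compose_rev[OF measurable_ennreal] R_y elim) simp
        qed (use bspec[OF elim(1) \<open>A \<in> H\<close>] in simp)
        also have "\<dots> = emeasure (G y) A * (ennreal (L y) * ennreal (1 / L y))"
          by (simp add: mult_ac)
        also have "ennreal (L y) * ennreal (1 / L y) = 1"
          using Ly by (simp add: ennreal_mult''[symmetric])
        finally show "emeasure (G y) A = emeasure (density (G' y) (\<lambda>w. ennreal (R y w / L y))) A"
          by simp
      next
        show "emeasure (G y) a \<noteq> \<infinity>" if "a \<in> {UNIV}" for a
          using prob_space.emeasure_eq_1_AE finite_measure.emeasure_finite[of "G y" a] G_sp(2)[OF elim(2)]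
          by (simp add: prob_space_def)
      qed (use H in auto)
    qed
  qed
qed

text \<open>The Taylor remainder of \<open>1 / (1 + x)\<close> at \<open>a\<close> in closed form,
  scaled by \<open>(1 + a)^2\<close> so that the linear term is \<open>b - a\<close>. For a random
  \<open>b\<close> with mean \<open>a\<close> this term vanishes, and the drift of the reciprocal
  measures the spread of \<open>b\<close>.\<close>

lemma reciprocal_taylor:
  fixes a b :: real
  assumes "0 \<le> a" "0 \<le> b"
  shows "(b - a)\<^sup>2 / (1 + b) = (1 + a)\<^sup>2 * (1 / (1 + b) - 1 / (1 + a)) + (b - a)"
proof -
  have "1 + a > 0" "1 + b > 0" using assms by auto
  then show ?thesis by (simp add: divide_simps) algebra
qed

text \<open>The arithmetic-geometric mean inequality for the factors \<open>sqrt (1 + b)\<close> and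
  \<open>\<bar>b - a\<bar> / sqrt (1 + b)\<close>. Leaving \<open>t\<close> free does the work of
  the Cauchy-Schwarz inequality after integration.\<close>

lemma abs_diff_le_reciprocal:
  fixes a b t :: real
  assumes "0 \<le> a" "0 \<le> b" "0 < t"
  shows "\<bar>b - a\<bar> \<le> t / 2 * (1 + b) + ((1 + a)\<^sup>2 * (1 / (1 + b) - 1 / (1 + a)) + (b - a)) / (2 * t)"
proof -
  have b: "1 + b > 0" using assms by auto
  have "0 \<le> (t * (1 + b) - \<bar>b - a\<bar>)\<^sup>2 / (2 * t * (1 + b))"
    using assms b by (intro divide_nonneg_pos) auto
  also have "\<dots> = t / 2 * (1 + b) + ((b - a)\<^sup>2 / (1 + b)) / (2 * t) - \<bar>b - a\<bar>"
    using b assms(3) by (simp add: divide_simps power2_diff) (simp add: algebra_simps power2_eq_square)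
  finally show ?thesis
    unfolding reciprocal_taylor[OF assms(1,2), symmetric] by simp
qed

section \<open>Spread of a density \<open>R\<close> around its mean \<open>L\<close>\<close>

context
  fixes K :: "'w measure" and R :: "'w \<Rightarrow> real" and L :: real
  assumes K: "prob_space K" and R [measurable]: "R \<in> borel_measurable K" and R_nonneg: "\<And>w. 0 \<le> R w"
    and L_nonneg: "0 \<le> L" and R_int: "(\<integral>\<^sup>+w. ennreal (R w) \<partial>K) = ennreal L"
begin

interpretation prob_space K by (rule K)

lemma integrable_reciprocal: "integrable K (\<lambda>w. 1 / (1 + R w))"
  by (rule integrable_const_bound[where B = 1]) (auto simp: R_nonneg add_pos_nonneg divide_le_eq)

lemma integrable_density: "integrable K R"
  using R_int R_nonneg by (intro integrableI_nonneg) auto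

lemma integral_density_eq: "(\<integral>w. R w \<partial>K) = L"
  using R_int R_nonneg L_nonneg by (simp add: integral_eq_nn_integral)

text \<open>Jensen's inequality, obtained by integrating the nonnegative remainder of
  \<open>reciprocal_taylor\<close>: as \<open>R\<close> has mean \<open>L\<close>, only the
  reciprocal terms survive.\<close>

lemma reciprocal_gap_nonneg: "0 \<le> (\<integral>w. 1 / (1 + R w) \<partial>K) - 1 / (1 + L)"
proof -
  have "0 \<le> (\<integral>w. (1 + L)\<^sup>2 * (1 / (1 + R w) - 1 / (1 + L)) + (R w - L) \<partial>K)"
    unfolding reciprocal_taylor[OF L_nonneg R_nonneg, symmetric]
    by (intro Bochner_Integration.integral_nonneg divide_nonneg_nonneg) (auto simp: R_nonneg add_nonneg_nonneg)
  also have "\<dots> = (1 + L)\<^sup>2 * ((\<integral>w. 1 / (1 + R w) \<partial>K) - 1 / (1 + L))"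
    by (simp add: integrable_reciprocal integrable_density integral_density_eq prob_space)
  finally show ?thesis
    using L_nonneg by (simp add: zero_le_mult_iff)
qed

text \<open>The two integrals differ by the integral of \<open>g w * (R w - L) / L\<close>, to which
  \<open>abs_diff_le_reciprocal\<close> applies pointwise. Integration replaces \<open>R w\<close>
  by \<open>L\<close>, which removes the linear term and leaves the gap.\<close>

lemma integral_diff_le_reciprocal_gap:
  assumes L: "0 < L" and t: "0 < t"
    and g: "g \<in> borel_measurable K" and c: "\<And>w. \<bar>g w\<bar> \<le> c"
  shows "\<bar>(\<integral>w. g w \<partial>density K (\<lambda>w. ennreal (R w / L))) - (\<integral>w. g w \<partial>K)\<bar> \<le>
    c / L * (t / 2 * (1 + L) + (1 + L)\<^sup>2 * ((\<integral>w. 1 / (1 + R w) \<partial>K) - 1 / (1 + L)) / (2 * t))"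
proof -
  note [measurable] = g
  have c0: "0 \<le> c" using c[of undefined] by linarith
  have g_int: "integrable K g"
    using c by (intro integrable_const_bound[where B = c]) auto
  have gR_int: "integrable K (\<lambda>w. g w * R w)"
    by (rule Bochner_Integration.integrable_bound[where f = "\<lambda>w. c * R w"])
      (use c0 in \<open>auto simp: abs_mult R_nonneg integrable_density intro!: mult_right_mono c\<close>)
  have "(\<integral>w. g w \<partial>density K (\<lambda>w. ennreal (R w / L))) = (\<integral>w. g w * R w / L \<partial>K)"
    using L R_nonneg by (subst integral_density) (auto simp: mult_ac)
  then have eq: "(\<integral>w. g w \<partial>density K (\<lambda>w. ennreal (R w / L))) - (\<integral>w. g w \<partial>K) = (\<integral>w. g w * R w / L - g w \<partial>K)"
    using g_int gR_int by simp
  have "\<bar>\<integral>w. g w * R w / L - g w \<partial>K\<bar> \<le> (\<integral>w. c / L * (t / 2 * (1 + R w) + ((1 + L)\<^sup>2 * (1 / (1 + R w) - 1 / (1 + L)) + (R w - L)) / (2 * t)) \<partial>K)"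
  proof (rule order_trans[OF integral_abs_bound integral_mono])
    fix w
    have "\<bar>g w * R w / L - g w\<bar> = \<bar>g w\<bar> / L * \<bar>R w - L\<bar>"
      using L by (simp add: abs_mult[symmetric] abs_divide field_simps flip: abs_mult)
    also have "\<dots> \<le> c / L * (t / 2 * (1 + R w) + ((1 + L)\<^sup>2 * (1 / (1 + R w) - 1 / (1 + L)) + (R w - L)) / (2 * t))"
      using c L c0 by (intro mult_mono abs_diff_le_reciprocal divide_right_mono R_nonneg t) auto
    finally show "\<bar>g w * R w / L - g w\<bar> \<le> \<dots>" .
  qed (use g_int gR_int integrable_reciprocal integrable_density in auto)
  also have "\<dots> = c / L * (t / 2 * (1 + L) + (1 + L)\<^sup>2 * ((\<integral>w. 1 / (1 + R w) \<partial>K) - 1 / (1 + L)) / (2 * t))"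
    by (simp add: integrable_reciprocal integrable_density integral_density_eq prob_space)
  finally show ?thesis unfolding eq .
qed

end

text \<open>The bounds on \<open>l n\<close> make all prefactors uniform in \<open>n\<close>; what
  remains is to balance \<open>t\<close> against \<open>W n / t\<close>.\<close>

lemma tendsto_zero_of_reciprocal_gap:
  fixes d l V :: "nat \<Rightarrow> real"
  assumes W: "(\<lambda>n. V n / (1 + l n)) \<longlonglongrightarrow> 0" and V: "\<And>n. 0 \<le> V n"
    and l: "0 < a" "\<And>n. a \<le> l n" "\<And>n. l n \<le> b" and "0 \<le> c"
    and d: "\<And>n t. 0 < t \<Longrightarrow> \<bar>d n\<bar> \<le> c / l n * (t / 2 * (1 + l n) + (1 + l n)\<^sup>2 * V n / (2 * t))"
  shows "d \<longlonglongrightarrow> 0"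
proof -
  define W where "W n = V n / (1 + l n)" for n
  have l0: "0 < l n" for n using l(1) l(2)[of n] by linarith
  have W0: "0 \<le> W n" for n using V[of n] l0[of n] by (simp add: W_def)
  \<comment> \<open>The minimiser of \<open>t + W n / t\<close> is \<open>sqrt (W n)\<close>, which
    may be zero; the second summand keeps \<open>t n\<close> positive and still tends to
    zero.\<close>
  define t where "t n = sqrt (W n) + 1 / real (Suc n)" for n
  have t0: "0 < t n" and tW: "sqrt (W n) \<le> t n" for n
    using W0[of n] by (auto simp: t_def add_nonneg_pos)
  have bnd: "\<bar>d n\<bar> \<le> c / a * (t n / 2 * (1 + b) + (1 + b)^3 / 2 * sqrt (W n))" for n
  proof -
    have "W n \<le> sqrt (W n) * t n"
      using mult_left_mono[OF tW[of n], of "sqrt (W n)"] W0[of n] by simp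
    then have "W n / t n \<le> sqrt (W n)" using t0[of n] by (simp add: divide_le_eq)
    have "(1 + l n)\<^sup>2 * V n / (2 * t n) = (1 + l n)^3 / 2 * (W n / t n)"
    proof -
      have "V n = W n * (1 + l n)" using l0[of n] by (simp add: W_def)
      then show ?thesis by (simp add: power2_eq_square power3_eq_cube)
    qed
    also have "\<dots> \<le> (1 + b)^3 / 2 * sqrt (W n)"
      using l0[of n] l(3)[of n] W0[of n] t0[of n] \<open>W n / t n \<le> sqrt (W n)\<close>
      by (intro mult_mono divide_right_mono power_mono) auto
    finally have 1: "(1 + l n)\<^sup>2 * V n / (2 * t n) \<le> (1 + b)^3 / 2 * sqrt (W n)" .
    have "\<bar>d n\<bar> \<le> c / l n * (t n / 2 * (1 + l n) + (1 + l n)\<^sup>2 * V n / (2 * t n))"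
      by (rule d[OF t0])
    also have "\<dots> \<le> c / a * (t n / 2 * (1 + b) + (1 + b)^3 / 2 * sqrt (W n))"
      using 1 l0[of n] l(1) l(2)[of n] l(3)[of n] t0[of n] V[of n] \<open>0 \<le> c\<close>
      by (intro mult_mono add_mono divide_left_mono) (auto intro!: mult_mono add_nonneg_nonneg)
    finally show ?thesis .
  qed
  have "(\<lambda>n. sqrt (W n)) \<longlonglongrightarrow> 0"
    using tendsto_real_sqrt[OF assms(1)] by (simp add: W_def)
  moreover have "(\<lambda>n. t n) \<longlonglongrightarrow> 0"
    unfolding t_def using tendsto_add[OF calculation lim_inverse_n'[THEN LIMSEQ_Suc]] by simp
  ultimately have "(\<lambda>n. c / a * (t n / 2 * (1 + b) + (1 + b)^3 / 2 * sqrt (W n))) \<longlonglongrightarrow> c / a * (0 / 2 * (1 + b) + (1 + b)^3 / 2 * 0)"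
    by (intro tendsto_intros) auto
  then have "(\<lambda>n. c / a * (t n / 2 * (1 + b) + (1 + b)^3 / 2 * sqrt (W n))) \<longlonglongrightarrow> 0" by simp
  then show ?thesis
    by (rule Lim_null_comparison[rotated]) (use bnd in auto)
qed

text \<open>Stated for functions bounded by one and not only for sets, because \<open>a x\<close>
  will be the probability of an observation event given the initial state \<open>x\<close>.\<close>

lemma absolutely_continuous_uniform:
  assumes \<nu>: "prob_space \<nu>" and \<mu>: "prob_space \<mu>" and sets_eq: "sets \<mu> = sets \<nu>"
    and ac: "absolutely_continuous \<nu> \<mu>" and e: "0 < (e :: real)"
  obtains d :: real where "0 < d"
    and "\<And>a. a \<in> borel_measurable \<nu> \<Longrightarrow> (\<And>x. a x \<le> (1 :: ennreal)) \<Longrightarrow>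
      (\<integral>\<^sup>+x. a x \<partial>\<nu>) \<le> ennreal d \<Longrightarrow> (\<integral>\<^sup>+x. a x \<partial>\<mu>) \<le> ennreal e"
proof -
  interpret \<nu>: prob_space \<nu> by fact
  interpret \<mu>: prob_space \<mu> by fact
  obtain r where r[measurable]: "r \<in> borel_measurable \<nu>" and RN: "AE x in \<nu>. RN_deriv \<nu> \<mu> x = ennreal (r x)"
    and r0: "\<And>x. 0 \<le> r x"
    using \<nu>.real_RN_deriv[OF \<mu>.finite_measure_axioms ac sets_eq] by blast
  have dens: "(\<integral>\<^sup>+x. a x \<partial>\<mu>) = (\<integral>\<^sup>+x. ennreal (r x) * a x \<partial>\<nu>)" if "a \<in> borel_measurable \<nu>" for a
    unfolding \<nu>.RN_deriv_nn_integral[OF ac sets_eq that] using RN by (intro nn_integral_cong_AE) auto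
  \<comment> \<open>The part of the density above level \<open>k\<close> has small integral, by
    dominated convergence with the density itself as bound.\<close>
  have "(\<lambda>k::nat. \<integral>\<^sup>+x. ennreal (r x) * indicator {x. real k < r x} x \<partial>\<nu>) \<longlonglongrightarrow> (\<integral>\<^sup>+x. 0 \<partial>\<nu>)"
  proof (rule nn_integral_dominated_convergence[where w = "\<lambda>x. ennreal (r x)"])
    show "(\<integral>\<^sup>+x. ennreal (r x) \<partial>\<nu>) < \<infinity>"
      using dens[of "\<lambda>_. 1"] \<mu>.emeasure_space_1 by simp
    show "AE x in \<nu>. (\<lambda>k. ennreal (r x) * indicator {x. real k < r x} x) \<longlonglongrightarrow> 0"
    proof (rule AE_I2)
      fix x
      obtain k0 :: nat where "r x \<le> real k0" using real_arch_simple by blast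
      then have "\<forall>k\<ge>k0. ennreal (r x) * indicator {x. real k < r x} x = 0"
        by (auto split: split_indicator)
      then show "(\<lambda>k. ennreal (r x) * indicator {x. real k < r x} x) \<longlonglongrightarrow> 0"
        by (intro tendsto_eventually) (auto simp: eventually_sequentially)
    qed
  qed (auto split: split_indicator)
  then have "eventually (\<lambda>k::nat. (\<integral>\<^sup>+x. ennreal (r x) * indicator {x. real k < r x} x \<partial>\<nu>) < ennreal (e / 2)) sequentially"
    using e by (intro order_tendstoD) auto
  then obtain k :: nat where k: "(\<integral>\<^sup>+x. ennreal (r x) * indicator {x. real k < r x} x \<partial>\<nu>) < ennreal (e / 2)"
    by (auto simp: eventually_sequentially)
  show ?thesis
  proof (rule that)
    \<comment> \<open>Half of \<open>e\<close> covers the region where the density exceeds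
      \<open>k\<close>. Elsewhere the density is at most \<open>k\<close>; using
      \<open>k + 1\<close> keeps the divisor positive.\<close>
    show "0 < e / (2 * (real k + 1))" using e by simp
    fix a assume a[measurable]: "a \<in> borel_measurable \<nu>" and a1: "\<And>x. a x \<le> (1 :: ennreal)"
      and le: "(\<integral>\<^sup>+x. a x \<partial>\<nu>) \<le> ennreal (e / (2 * (real k + 1)))"
    have "(\<integral>\<^sup>+x. a x \<partial>\<mu>) = (\<integral>\<^sup>+x. ennreal (r x) * a x \<partial>\<nu>)" by (rule dens[OF a])
    also have "\<dots> \<le> (\<integral>\<^sup>+x. ennreal (real k + 1) * a x + ennreal (r x) * indicator {x. real k < r x} x \<partial>\<nu>)"
    proof (rule nn_integral_mono)
      fix x
      show "ennreal (r x) * a x \<le> ennreal (real k + 1) * a x + ennreal (r x) * indicator {x. real k < r x} x"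
      proof (cases "real k < r x")
        case True
        then have "ennreal (r x) * a x \<le> ennreal (r x) * 1" using a1 by (intro mult_left_mono) auto
        with True show ?thesis by (simp add: add_increasing)
      next
        case False
        then have "ennreal (r x) * a x \<le> ennreal (real k + 1) * a x"
          by (intro mult_right_mono ennreal_leI) auto
        with False show ?thesis by simp
      qed
    qed
    also have "\<dots> = ennreal (real k + 1) * (\<integral>\<^sup>+x. a x \<partial>\<nu>) + (\<integral>\<^sup>+x. ennreal (r x) * indicator {x. real k < r x} x \<partial>\<nu>)"
      by (simp add: nn_integral_add nn_integral_cmult)
    also have "\<dots> \<le> ennreal (real k + 1) * ennreal (e / (2 * (real k + 1))) + ennreal (e / 2)"
      using le k by (intro add_mono mult_left_mono) auto
    also have "\<dots> = ennreal ((real k + 1) * (e / (2 * (real k + 1))) + e / 2)"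
      using e by (simp only: ennreal_mult[symmetric] ennreal_plus[symmetric] divide_nonneg_nonneg mult_nonneg_nonneg
        add_nonneg_nonneg of_nat_0_le_iff zero_le_one zero_le_numeral less_imp_le)
    also have "(real k + 1) * (e / (2 * (real k + 1))) + e / 2 = e"
      by (simp add: field_simps)
    finally show "(\<integral>\<^sup>+x. a x \<partial>\<mu>) \<le> ennreal e" .
  qed
qed

text \<open>The sum telescopes with stride \<open>N\<close>: at most \<open>N\<close> values of
  \<open>a\<close> are left, each at most one. In \<open>ennreal\<close> the cancellation requires
  finite partial sums, which \<open>a1\<close> provides.\<close>

lemma suminf_le_of_telescoping:
  fixes e a :: "nat \<Rightarrow> ennreal"
  assumes step: "\<And>n. e n + a n \<le> a (n + N)" and a1: "\<And>n. a n \<le> 1"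
  shows "(\<Sum>n. e n) \<le> of_nat N"
  unfolding suminf_eq_SUP
proof (rule SUP_least)
  fix m
  have fin: "(\<Sum>n<m. a n) \<noteq> \<infinity>"
    using a1 by (auto simp: top_unique dest: order_trans) (metis ennreal_one_less_top leD top.not_eq_extremum)
  have "(\<Sum>n<m. a n) + (\<Sum>n<m. e n) = (\<Sum>n<m. e n + a n)"
    by (simp add: sum.distrib add.commute)
  also have "\<dots> \<le> (\<Sum>n<m. a (n + N))"
    by (rule sum_mono[OF step])
  also have "\<dots> = (\<Sum>n\<in>{N..<m + N}. a n)"
    using sum.shift_bounds_nat_ivl[of a 0 N m] by (simp add: lessThan_atLeast0)
  also have "\<dots> \<le> (\<Sum>n\<in>{..<m + N}. a n)"
    by (intro sum_mono2) auto
  also have "\<dots> = (\<Sum>n<m. a n) + (\<Sum>n\<in>{m..<m + N}. a n)"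
    by (subst sum.union_disjoint[symmetric]) (auto intro!: sum.cong)
  also have "\<dots> \<le> (\<Sum>n<m. a n) + of_nat N"
    using sum_mono[of "{m..<m + N}" a "\<lambda>_. 1", OF a1] by (intro add_left_mono) simp
  finally show "(\<Sum>n<m. e n) \<le> of_nat N"
    using fin by simp
qed

section \<open>Sequences of observations\<close>

lemma measurable_product_coordinate:
  "(\<lambda>y. y i) \<in> borel_measurable (borel :: ('i::countable \<Rightarrow> 'b::second_countable_topology) measure)"
  by simp

lemma measurable_restrict_borel [measurable]:
  "(\<lambda>y. restrict y {..<n}) \<in> (borel :: (nat \<Rightarrow> 'b::polish_space) measure) \<rightarrow>\<^sub>M borel"
proof (rule measurable_coordinatewise_then_product)
  fix i
  show "(\<lambda>y. restrict y {..<n} i) \<in> (borel :: (nat \<Rightarrow> 'b) measure) \<rightarrow>\<^sub>M borel"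
    by (cases "i < n") (simp_all add: measurable_product_coordinate)
qed

lemma measurable_restrict_PiM [measurable]:
  "(\<lambda>y. restrict y {..<n}) \<in> (borel :: (nat \<Rightarrow> 'b::polish_space) measure) \<rightarrow>\<^sub>M PiM {..<n} (\<lambda>_. borel)"
  by (intro measurable_restrict measurable_product_coordinate)

text \<open>The argument \<open>k\<close> only serves to leave \<open>y\<close> unchanged beyond time \<open>n + k\<close>.\<close>

definition glue :: "nat \<Rightarrow> nat \<Rightarrow> (nat \<Rightarrow> 'b) \<Rightarrow> (nat \<Rightarrow> 'b) \<Rightarrow> nat \<Rightarrow> 'b" where
  "glue n k y w = (\<lambda>i. if n \<le> i \<and> i < n + k then w (i - n) else y i)"

lemma restrict_glue [simp]: "restrict (glue n k y w) {..<n} = restrict y {..<n}"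
  by (auto simp: glue_def)

lemma measurable_glue [measurable (raw)]:
  fixes f g :: "'a \<Rightarrow> nat \<Rightarrow> 'b::polish_space"
  assumes f: "f \<in> M \<rightarrow>\<^sub>M borel" and g: "g \<in> M \<rightarrow>\<^sub>M borel"
  shows "(\<lambda>s. glue n k (f s) (g s)) \<in> M \<rightarrow>\<^sub>M borel"
proof (rule measurable_coordinatewise_then_product)
  fix i
  have "(\<lambda>s. g s (i - n)) \<in> M \<rightarrow>\<^sub>M borel" "(\<lambda>s. f s i) \<in> M \<rightarrow>\<^sub>M borel"
    using measurable_compose[OF f measurable_product_coordinate] measurable_compose[OF g measurable_product_coordinate] by blast+
  then show "(\<lambda>s. glue n k (f s) (g s) i) \<in> M \<rightarrow>\<^sub>M borel"
    unfolding glue_def by (cases "n \<le> i \<and> i < n + k") auto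
qed

text \<open>Observation vectors are functions on all of \<open>nat\<close>, equal to
  \<open>undefined\<close> from \<open>n\<close> on, so that all lengths share one Borel space.
  Predictors live on \<open>PiM {..<n}\<close>; this embedding links the two.\<close>

lemma measurable_id_PiM_borel:
  "(\<lambda>y. y) \<in> PiM {..<n} (\<lambda>_. borel) \<rightarrow>\<^sub>M (borel :: (nat \<Rightarrow> 'b::polish_space) measure)"
proof (rule measurable_coordinatewise_then_product)
  fix i
  show "(\<lambda>y. y i) \<in> PiM {..<n} (\<lambda>_. borel :: 'b measure) \<rightarrow>\<^sub>M borel"
  proof (cases "i < n")
    case False
    have "(\<lambda>y. y i) \<in> PiM {..<n} (\<lambda>_. borel :: 'b measure) \<rightarrow>\<^sub>M borel \<longleftrightarrow>
        (\<lambda>_. undefined) \<in> PiM {..<n} (\<lambda>_. borel :: 'b measure) \<rightarrow>\<^sub>M (borel :: 'b measure)"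
      using False by (intro measurable_cong) (auto simp: space_PiM PiE_def extensional_def)
    then show ?thesis by simp
  qed (intro measurable_component_singleton, simp)
qed

definition shift :: "nat \<Rightarrow> nat \<Rightarrow> (nat \<Rightarrow> 'b) \<Rightarrow> nat \<Rightarrow> 'b" where
  "shift n N y = (\<lambda>i\<in>{..<N}. y (n + i))"

lemma measurable_shift [measurable]:
  "shift n N \<in> (borel :: (nat \<Rightarrow> 'b::polish_space) measure) \<rightarrow>\<^sub>M borel"
proof (rule measurable_coordinatewise_then_product)
  fix i
  show "(\<lambda>y. shift n N y i) \<in> (borel :: (nat \<Rightarrow> 'b) measure) \<rightarrow>\<^sub>M borel"
    by (cases "i < N") (simp_all add: shift_def measurable_product_coordinate)
qed

lemma shift_glue: "shift n N (glue n N y w) = restrict w {..<N}"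
  by (auto simp: shift_def glue_def)

lemma glue_shift: "glue n N (restrict y {..<n}) (shift n N y) = restrict y {..<n + N}"
  by (auto simp: shift_def glue_def fun_eq_iff)

section \<open>Finite-dimensional laws of the model\<close>

locale pomp =
  fixes T :: "'x::polish_space \<Rightarrow> 'x measure"
    and Q :: "'z::polish_space measure"
    and h :: "'x \<times> 'z \<Rightarrow> 'y::polish_space"
  assumes T [measurable]: "T \<in> borel \<rightarrow>\<^sub>M prob_algebra borel"
    and Q: "prob_space Q" and sets_Q [simp, measurable_cong]: "sets Q = sets borel"
    and h': "h \<in> borel_measurable borel"
begin

abbreviation "prior \<mu> \<equiv> \<mu> \<in> space (prob_algebra borel)"

lemma T' [measurable]: "T \<in> borel \<rightarrow>\<^sub>M subprob_algebra borel"
  by (rule measurable_prob_algebraD[OF T])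

lemma h [measurable]: "h \<in> borel \<Otimes>\<^sub>M borel \<rightarrow>\<^sub>M borel"
  using h' by (simp only: borel_prod)

lemma sets_PiM_Q [simp, measurable_cong]: "sets (PiM I (\<lambda>_. Q)) = sets (PiM I (\<lambda>_. borel))"
  by (rule sets_PiM_cong) auto

lemma space_PiM_Q [simp]: "space (PiM I (\<lambda>_. Q)) = space (PiM I (\<lambda>_. borel))"
  using sets_PiM_Q by (rule sets_eq_imp_space_eq)

lemma prob_PiM_Q: "prob_space (PiM I (\<lambda>_. Q))"
  by (intro prob_space_PiM Q)

lemma T_space: "sets (T x) = sets borel" "prob_space (T x)"
  using measurable_space[OF T, of x] by (auto simp: space_prob_algebra)

lemma measurable_step [measurable]:
  "(\<lambda>p. distr (T (p n)) (PiM {..Suc n} (\<lambda>_. borel)) (\<lambda>x. p(Suc n := x)))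
    \<in> PiM {..n} (\<lambda>_. borel) \<rightarrow>\<^sub>M prob_algebra (PiM {..Suc n} (\<lambda>_. borel))"
proof (rule measurable_distr_prob_space2[where M = borel])
  show "(\<lambda>p. T (p n)) \<in> PiM {..n} (\<lambda>_. borel) \<rightarrow>\<^sub>M prob_algebra borel"
    by (rule measurable_compose[OF _ T]) simp
  show "(\<lambda>(p, x). p(Suc n := x)) \<in> PiM {..n} (\<lambda>_. borel) \<Otimes>\<^sub>M borel \<rightarrow>\<^sub>M PiM {..Suc n} (\<lambda>_. borel)"
    using measurable_add_dim[of "Suc n" "{..n}" "\<lambda>_. borel"] by (simp add: atMost_Suc)
qed

declare path_law.simps [simp del]

lemma path_law: "prior \<mu> \<Longrightarrow> path_law T \<mu> n \<in> space (prob_algebra (PiM {..n} (\<lambda>_. borel)))"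
proof (induction n)
  case 0
  then have [measurable_cong]: "sets \<mu> = sets borel" and "prob_space \<mu>"
    by (auto simp: space_prob_algebra)
  then show ?case
    by (auto simp: space_prob_algebra path_law.simps intro!: prob_space.prob_space_distr)
next
  case (Suc n)
  from Suc.IH[OF Suc.prems] show ?case
    by (auto simp: space_prob_algebra path_law.simps prob_space_bind'[OF _ measurable_step] sets_bind'[OF _ measurable_step])
qed

lemma sets_path_law [measurable_cong]: "prior \<mu> \<Longrightarrow> sets (path_law T \<mu> n) = sets (PiM {..n} (\<lambda>_. borel))"
  and prob_space_path_law: "prior \<mu> \<Longrightarrow> prob_space (path_law T \<mu> n)"
  using path_law[of \<mu> n] by (auto simp: space_prob_algebra)

lemma nn_integral_path_law_Suc:
  assumes "prior \<mu>" and f[measurable]: "f \<in> borel_measurable (PiM {..Suc n} (\<lambda>_. borel))"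
  shows "(\<integral>\<^sup>+p. f p \<partial>path_law T \<mu> (Suc n)) = (\<integral>\<^sup>+p. \<integral>\<^sup>+x. f (p(Suc n := x)) \<partial>T (p n) \<partial>path_law T \<mu> n)"
proof -
  note sets_path_law[OF assms(1), measurable_cong]
  have "(\<integral>\<^sup>+p. f p \<partial>path_law T \<mu> (Suc n)) =
    (\<integral>\<^sup>+p. \<integral>\<^sup>+x. f x \<partial>distr (T (p n)) (PiM {..Suc n} (\<lambda>_. borel)) (\<lambda>x. p(Suc n := x)) \<partial>path_law T \<mu> n)"
    unfolding path_law.simps
    by (rule nn_integral_bind[OF f]) (rule measurable_prob_algebraD, measurable)
  also have "\<dots> = (\<integral>\<^sup>+p. \<integral>\<^sup>+x. f (p(Suc n := x)) \<partial>T (p n) \<partial>path_law T \<mu> n)"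
  proof (rule nn_integral_cong)
    fix p assume "p \<in> space (path_law T \<mu> n)"
    then have p: "p \<in> space (PiM {..n} (\<lambda>_. borel))"
      using sets_eq_imp_space_eq[OF sets_path_law[OF assms(1)]] by auto
    have "(\<lambda>x. p(Suc n := x)) \<in> borel \<rightarrow>\<^sub>M PiM {..Suc n} (\<lambda>_. borel)"
      using measurable_compose[OF measurable_Pair1'[OF p] measurable_add_dim[of "Suc n" "{..n}" "\<lambda>_. borel"]]
      by (simp add: atMost_Suc)
    then have "(\<lambda>x. p(Suc n := x)) \<in> T (p n) \<rightarrow>\<^sub>M PiM {..Suc n} (\<lambda>_. borel)"
      by (simp add: T_space cong: measurable_cong_sets)
    then show "(\<integral>\<^sup>+x. f x \<partial>distr (T (p n)) (PiM {..Suc n} (\<lambda>_. borel)) (\<lambda>x. p(Suc n := x))) =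
       (\<integral>\<^sup>+x. f (p(Suc n := x)) \<partial>T (p n))"
      by (rule nn_integral_distr) measurable
  qed
  finally show ?thesis .
qed

lemma nn_integral_noise_Suc:
  assumes "f \<in> borel_measurable (PiM {..<Suc n} (\<lambda>_. borel))"
  shows "(\<integral>\<^sup>+z. f z \<partial>PiM {..<Suc n} (\<lambda>_. Q)) = (\<integral>\<^sup>+z. \<integral>\<^sup>+v. f (z(n := v)) \<partial>Q \<partial>PiM {..<n} (\<lambda>_. Q))"
proof -
  interpret Q: prob_space Q by (rule Q)
  interpret product_sigma_finite "\<lambda>_. Q" by standard
  have "f \<in> borel_measurable (PiM (insert n {..<n}) (\<lambda>_. Q))"
    using assms by (simp add: lessThan_Suc cong: measurable_cong_sets)
  from product_nn_integral_insert[OF _ _ this] show ?thesis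
    by (simp add: lessThan_Suc)
qed

lemma sets_xz_law [measurable_cong]:
  "prior \<mu> \<Longrightarrow> sets (xz_law T Q \<mu> n) = sets (PiM {..n} (\<lambda>_. borel) \<Otimes>\<^sub>M PiM {..n} (\<lambda>_. borel))"
  unfolding xz_law_def by (intro sets_pair_measure_cong sets_path_law) simp_all

lemma prob_space_xz_law: "prior \<mu> \<Longrightarrow> prob_space (xz_law T Q \<mu> n)"
  unfolding xz_law_def by (intro prob_space_pair prob_space_path_law prob_PiM_Q)

lemma measurable_obs_vec [measurable]:
  assumes "n \<le> Suc m" "n \<le> k"
  shows "obs_vec h n \<in> PiM {..m} (\<lambda>_. borel) \<Otimes>\<^sub>M PiM {..<k} (\<lambda>_. borel) \<rightarrow>\<^sub>M borel"
proof (rule measurable_coordinatewise_then_product)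
  fix i
  show "(\<lambda>p. obs_vec h n p i) \<in> PiM {..m} (\<lambda>_. borel) \<Otimes>\<^sub>M PiM {..<k} (\<lambda>_. borel) \<rightarrow>\<^sub>M borel"
  proof (cases "i < n")
    case True
    with assms have [simp]: "i \<in> {..m}" "i \<in> {..<k}" by auto
    have "(\<lambda>p. h (fst p i, snd p i)) \<in> PiM {..m} (\<lambda>_. borel) \<Otimes>\<^sub>M PiM {..<k} (\<lambda>_. borel) \<rightarrow>\<^sub>M borel"
      by (rule measurable_compose[OF _ h]) (use True assms in \<open>auto intro!: measurable_Pair
        measurable_compose[OF measurable_fst measurable_component_singleton]
        measurable_compose[OF measurable_snd measurable_component_singleton]\<close>)
    then show ?thesis using True by (simp add: obs_vec_def)
  qed (simp add: obs_vec_def)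
qed

lemma measurable_obs_vec' [measurable]:
  "n \<le> Suc m \<Longrightarrow> obs_vec h n \<in> PiM {..m} (\<lambda>_. borel) \<Otimes>\<^sub>M PiM {..m} (\<lambda>_. borel) \<rightarrow>\<^sub>M borel"
  using measurable_obs_vec[of n m "Suc m"] by (simp add: lessThan_Suc_atMost)

lemma measurable_obs_state:
  "prior \<mu> \<Longrightarrow> (\<lambda>p. (obs_vec h n p, fst p n)) \<in> xz_law T Q \<mu> n \<rightarrow>\<^sub>M borel \<Otimes>\<^sub>M borel"
  by (subst measurable_cong_sets[OF sets_xz_law refl]) (auto intro!: measurable_Pair measurable_obs_vec' measurable_compose[OF measurable_fst measurable_component_singleton])

lemma measurable_obs_state_swap:
  assumes "prior \<mu>" "n \<le> Suc m" "n \<le> k" "j \<le> m"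
  shows "(\<lambda>s. (obs_vec h n (snd s, fst s), snd s j)) \<in> PiM {..<k} (\<lambda>_. Q) \<Otimes>\<^sub>M path_law T \<mu> m \<rightarrow>\<^sub>M borel \<Otimes>\<^sub>M borel"
proof -
  have "(\<lambda>s. (obs_vec h n (snd s, fst s), snd s j)) \<in> PiM {..<k} (\<lambda>_. borel) \<Otimes>\<^sub>M PiM {..m} (\<lambda>_. borel) \<rightarrow>\<^sub>M borel \<Otimes>\<^sub>M borel"
    using assms by (intro measurable_Pair measurable_compose[OF _ measurable_obs_vec[of n m k]]
        measurable_compose[OF measurable_snd measurable_component_singleton] measurable_snd measurable_fst) auto
  then show ?thesis
    by (rule back_subst[where P = "\<lambda>S. _ \<in> S"]) (intro measurable_cong_sets sets_pair_measure_cong sets_PiM_Q[symmetric] sets_path_law[symmetric] assms refl)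
qed

text \<open>The noise at time \<open>n\<close> is integrated out: it does not enter the first \<open>n\<close> observations.\<close>

lemma nn_integral_xz_law_obs_vec:
  assumes "prior \<mu>" and f[measurable]: "f \<in> borel_measurable (borel \<Otimes>\<^sub>M borel)"
  shows "(\<integral>\<^sup>+p. f (obs_vec h n p, fst p n) \<partial>xz_law T Q \<mu> n) =
    (\<integral>\<^sup>+z. \<integral>\<^sup>+p. f (obs_vec h n (p, z), p n) \<partial>path_law T \<mu> n \<partial>PiM {..<n} (\<lambda>_. Q))"
proof -
  note [measurable_cong] = sets_path_law[OF assms(1)]
  interpret P: prob_space "path_law T \<mu> n" by (rule prob_space_path_law[OF assms(1)])
  interpret R: prob_space "PiM {..n} (\<lambda>_. Q)" by (rule prob_PiM_Q)
  interpret PR: pair_sigma_finite "path_law T \<mu> n" "PiM {..n} (\<lambda>_. Q)" ..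
  interpret Q: prob_space Q by (rule Q)
  have "(\<integral>\<^sup>+p. f (obs_vec h n p, fst p n) \<partial>xz_law T Q \<mu> n) =
     (\<integral>\<^sup>+z. \<integral>\<^sup>+p. f (obs_vec h n (p, z), p n) \<partial>path_law T \<mu> n \<partial>PiM {..<Suc n} (\<lambda>_. Q))"
    unfolding xz_law_def lessThan_Suc_atMost
    by (subst PR.nn_integral_snd[symmetric])
      (use measurable_compose[OF measurable_obs_state[OF assms(1), unfolded xz_law_def] f] in simp_all)
  also have "\<dots> = (\<integral>\<^sup>+z. \<integral>\<^sup>+v. \<integral>\<^sup>+p. f (obs_vec h n (p, z(n := v)), p n) \<partial>path_law T \<mu> n \<partial>Q \<partial>PiM {..<n} (\<lambda>_. Q))"
    by (intro nn_integral_noise_Suc) (use P.borel_measurable_nn_integral[of "\<lambda>z p. f (obs_vec h n (p, z), p n)" "PiM {..<Suc n} (\<lambda>_. Q)"]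
        measurable_compose[OF measurable_obs_state_swap[OF assms(1)] f, of n n "Suc n" n] in \<open>simp add: case_prod_beta cong: measurable_cong_sets\<close>)
  also have "\<dots> = (\<integral>\<^sup>+z. \<integral>\<^sup>+v. \<integral>\<^sup>+p. f (obs_vec h n (p, z), p n) \<partial>path_law T \<mu> n \<partial>Q \<partial>PiM {..<n} (\<lambda>_. Q))"
  proof -
    have "obs_vec h n (p, z(n := v)) = obs_vec h n (p, z)" for p z v
      by (auto simp: obs_vec_def fun_eq_iff)
    then show ?thesis by simp
  qed
  finally show ?thesis by (simp add: Q.emeasure_space_1)
qed

section \<open>The Markov chain of observation history and current state\<close>

definition joint :: "'x measure \<Rightarrow> nat \<Rightarrow> ((nat \<Rightarrow> 'y) \<times> 'x) measure" where
  "joint \<mu> n = distr (xz_law T Q \<mu> n) (borel \<Otimes>\<^sub>M borel) (\<lambda>p. (obs_vec h n p, fst p n))"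

text \<open>The conditional expectation of \<open>f ((Y\<^sub>0, \<dots>, Y\<^sub>n), X\<^sub>n\<^sub>+\<^sub>1)\<close> given \<open>((Y\<^sub>0, \<dots>, Y\<^sub>n\<^sub>-\<^sub>1), X\<^sub>n) = (y, x)\<close>.\<close>

definition bwd :: "nat \<Rightarrow> ((nat \<Rightarrow> 'y) \<times> 'x \<Rightarrow> ennreal) \<Rightarrow> (nat \<Rightarrow> 'y) \<times> 'x \<Rightarrow> ennreal" where
  "bwd n f = (\<lambda>(y, x). \<integral>\<^sup>+z. \<integral>\<^sup>+x'. f (y(n := h (x, z)), x') \<partial>T x \<partial>Q)"

lemma sets_joint [simp, measurable_cong]: "sets (joint \<mu> n) = sets (borel \<Otimes>\<^sub>M borel)"
  by (simp add: joint_def)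

lemma prob_space_joint: "prior \<mu> \<Longrightarrow> prob_space (joint \<mu> n)"
  unfolding joint_def by (intro prob_space.prob_space_distr prob_space_xz_law measurable_obs_state)

lemma measurable_fun_upd_borel [measurable]:
  "(\<lambda>(y, v). y(n := v)) \<in> (borel :: (nat \<Rightarrow> 'b::polish_space) measure) \<Otimes>\<^sub>M borel \<rightarrow>\<^sub>M borel"
proof (rule measurable_coordinatewise_then_product)
  fix i
  show "(\<lambda>p. (case p of (y, v) \<Rightarrow> y(n := v)) i) \<in> (borel :: (nat \<Rightarrow> 'b) measure) \<Otimes>\<^sub>M borel \<rightarrow>\<^sub>M borel"
    by (cases "i = n") (simp_all add: case_prod_beta measurable_compose[OF measurable_fst measurable_product_coordinate])
qed

lemma measurable_bwd [measurable]:
  assumes [measurable]: "f \<in> borel_measurable (borel \<Otimes>\<^sub>M borel)"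
  shows "bwd n f \<in> borel_measurable (borel \<Otimes>\<^sub>M borel)"
proof -
  interpret Q: prob_space Q by (rule Q)
  have 1: "(\<lambda>s. (fst (fst s))(n := h (snd (fst s), snd s))) \<in> (borel \<Otimes>\<^sub>M borel) \<Otimes>\<^sub>M Q \<rightarrow>\<^sub>M borel"
    using measurable_compose[of "\<lambda>s. (fst (fst s), h (snd (fst s), snd s))" "(borel \<Otimes>\<^sub>M borel) \<Otimes>\<^sub>M Q", OF _ measurable_fun_upd_borel]
    by simp
  have 2: "(\<lambda>s. \<integral>\<^sup>+x'. f ((fst (fst s))(n := h (snd (fst s), snd s)), x') \<partial>T (snd (fst s))) \<in> borel_measurable ((borel \<Otimes>\<^sub>M borel) \<Otimes>\<^sub>M Q)"
    by (rule nn_integral_measurable_subprob_algebra2[where N = borel]) (use 1 in measurable)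
  then show ?thesis
    unfolding bwd_def case_prod_beta by (intro Q.borel_measurable_nn_integral) (simp add: case_prod_beta)
qed

lemma nn_integral_joint:
  assumes "prior \<mu>" "f \<in> borel_measurable (borel \<Otimes>\<^sub>M borel)"
  shows "(\<integral>\<^sup>+s. f s \<partial>joint \<mu> n) = (\<integral>\<^sup>+p. f (obs_vec h n p, fst p n) \<partial>xz_law T Q \<mu> n)"
  using assms by (simp add: joint_def nn_integral_distr measurable_obs_state)

text \<open>One step adds the state at time \<open>n + 1\<close> but the noise at time
  \<open>n\<close>, since \<open>joint\<close> pairs a state with strictly earlier observations.
  Exchanging the new noise with the old path brings the iterated integral into the form of
  \<open>bwd\<close>.\<close>

lemma nn_integral_joint_Suc:
  assumes "prior \<mu>" and f[measurable]: "f \<in> borel_measurable (borel \<Otimes>\<^sub>M borel)"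
  shows "(\<integral>\<^sup>+s. f s \<partial>joint \<mu> (Suc n)) = (\<integral>\<^sup>+s. bwd n f s \<partial>joint \<mu> n)"
proof -
  note [measurable_cong] = sets_path_law[OF assms(1)]
  interpret P: prob_space "path_law T \<mu> n" by (rule prob_space_path_law[OF assms(1)])
  interpret P': prob_space "path_law T \<mu> (Suc n)" by (rule prob_space_path_law[OF assms(1)])
  interpret Q: prob_space Q by (rule Q)
  interpret PQ: pair_sigma_finite "path_law T \<mu> n" Q ..
  have obs: "obs_vec h (Suc n) (p(Suc n := x), z(n := v)) = (obs_vec h n (p, z))(n := h (p n, v))" for p z x v
    by (auto simp: obs_vec_def fun_eq_iff)
  have "(\<integral>\<^sup>+s. f s \<partial>joint \<mu> (Suc n)) =
      (\<integral>\<^sup>+z. \<integral>\<^sup>+p. f (obs_vec h (Suc n) (p, z), p (Suc n)) \<partial>path_law T \<mu> (Suc n) \<partial>PiM {..<Suc n} (\<lambda>_. Q))"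
    using assms by (simp only: nn_integral_joint nn_integral_xz_law_obs_vec)
  also have "\<dots> = (\<integral>\<^sup>+z. \<integral>\<^sup>+v. \<integral>\<^sup>+p. f (obs_vec h (Suc n) (p, z(n := v)), p (Suc n)) \<partial>path_law T \<mu> (Suc n) \<partial>Q \<partial>PiM {..<n} (\<lambda>_. Q))"
    by (intro nn_integral_noise_Suc) (use P'.borel_measurable_nn_integral[of "\<lambda>z p. f (obs_vec h (Suc n) (p, z), p (Suc n))" "PiM {..<Suc n} (\<lambda>_. Q)"]
        measurable_compose[OF measurable_obs_state_swap[OF assms(1)] f, of "Suc n" "Suc n" "Suc n" "Suc n"] in \<open>simp add: case_prod_beta cong: measurable_cong_sets\<close>)
  also have "\<dots> = (\<integral>\<^sup>+z. \<integral>\<^sup>+v. \<integral>\<^sup>+p. \<integral>\<^sup>+x. f ((obs_vec h n (p, z))(n := h (p n, v)), x) \<partial>T (p n) \<partial>path_law T \<mu> n \<partial>Q \<partial>PiM {..<n} (\<lambda>_. Q))"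
  proof (intro nn_integral_cong)
    fix z v assume z: "z \<in> space (PiM {..<n} (\<lambda>_. Q))"
    have *: "(z(n := v)) \<in> space (PiM {..<Suc n} (\<lambda>_. borel))"
      using z by (auto simp: space_PiM PiE_def extensional_def)
    have "(\<lambda>p. obs_vec h (Suc n) (p, z(n := v))) \<in> PiM {..Suc n} (\<lambda>_. borel) \<rightarrow>\<^sub>M borel"
      by (rule measurable_compose[OF measurable_Pair2'[OF *] measurable_obs_vec]) auto
    then have "(\<lambda>p. f (obs_vec h (Suc n) (p, z(n := v)), p (Suc n))) \<in> borel_measurable (PiM {..Suc n} (\<lambda>_. borel))"
      by measurable
    from nn_integral_path_law_Suc[OF assms(1) this]
    show "(\<integral>\<^sup>+p. f (obs_vec h (Suc n) (p, z(n := v)), p (Suc n)) \<partial>path_law T \<mu> (Suc n)) =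
       (\<integral>\<^sup>+p. \<integral>\<^sup>+x. f ((obs_vec h n (p, z))(n := h (p n, v)), x) \<partial>T (p n) \<partial>path_law T \<mu> n)"
      by (simp add: obs)
  qed
  also have "\<dots> = (\<integral>\<^sup>+z. \<integral>\<^sup>+p. \<integral>\<^sup>+v. \<integral>\<^sup>+x. f ((obs_vec h n (p, z))(n := h (p n, v)), x) \<partial>T (p n) \<partial>Q \<partial>path_law T \<mu> n \<partial>PiM {..<n} (\<lambda>_. Q))"
  proof (intro nn_integral_cong PQ.Fubini')
    fix z assume z: "z \<in> space (PiM {..<n} (\<lambda>_. Q))"
    then have z: "z \<in> space (PiM {..<n} (\<lambda>_. borel))" by simp
    have "(\<lambda>p. obs_vec h n (p, z)) \<in> PiM {..n} (\<lambda>_. borel) \<rightarrow>\<^sub>M borel"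
      by (rule measurable_compose[OF measurable_Pair2'[OF z] measurable_obs_vec]) auto
    then have [measurable]: "(\<lambda>p. obs_vec h n (p, z)) \<in> path_law T \<mu> n \<rightarrow>\<^sub>M borel" by measurable
    have 1: "(\<lambda>s. (obs_vec h n (fst s, z))(n := h (fst s n, snd s))) \<in> path_law T \<mu> n \<Otimes>\<^sub>M Q \<rightarrow>\<^sub>M borel"
      using measurable_compose[of "\<lambda>s. (obs_vec h n (fst s, z), h (fst s n, snd s))" "path_law T \<mu> n \<Otimes>\<^sub>M Q", OF _ measurable_fun_upd_borel]
      by simp
    show "(\<lambda>(p, v). \<integral>\<^sup>+x. f ((obs_vec h n (p, z))(n := h (p n, v)), x) \<partial>T (p n)) \<in> borel_measurable (path_law T \<mu> n \<Otimes>\<^sub>M Q)"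
      unfolding case_prod_beta
      by (rule nn_integral_measurable_subprob_algebra2[where N = borel]) (use 1 in measurable)
  qed
  also have "\<dots> = (\<integral>\<^sup>+z. \<integral>\<^sup>+p. bwd n f (obs_vec h n (p, z), p n) \<partial>path_law T \<mu> n \<partial>PiM {..<n} (\<lambda>_. Q))"
    by (simp add: bwd_def)
  also have "\<dots> = (\<integral>\<^sup>+s. bwd n f s \<partial>joint \<mu> n)"
    using assms by (simp only: nn_integral_joint nn_integral_xz_law_obs_vec measurable_bwd)
  finally show ?thesis .
qed

text \<open>The latest transition acts on \<open>f\<close> first; this order suits an induction on
  \<open>k\<close> with \<open>f\<close> arbitrary.\<close>

primrec bwds :: "nat \<Rightarrow> nat \<Rightarrow> ((nat \<Rightarrow> 'y) \<times> 'x \<Rightarrow> ennreal) \<Rightarrow> (nat \<Rightarrow> 'y) \<times> 'x \<Rightarrow> ennreal" where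
  "bwds n 0 f = f"
| "bwds n (Suc k) f = bwds n k (bwd (n + k) f)"

lemma measurable_bwds [measurable]:
  "f \<in> borel_measurable (borel \<Otimes>\<^sub>M borel) \<Longrightarrow> bwds n k f \<in> borel_measurable (borel \<Otimes>\<^sub>M borel)"
  by (induction k arbitrary: f) auto

lemma nn_integral_joint_add:
  assumes "prior \<mu>" and "f \<in> borel_measurable (borel \<Otimes>\<^sub>M borel)"
  shows "(\<integral>\<^sup>+s. f s \<partial>joint \<mu> (n + k)) = (\<integral>\<^sup>+s. bwds n k f s \<partial>joint \<mu> n)"
  using assms(2)
proof (induction k arbitrary: f)
  case (Suc k)
  then show ?case
    by (simp add: nn_integral_joint_Suc[OF assms(1)])
qed simp

lemma nn_integral_joint_0:
  assumes "prior \<mu>" and f[measurable]: "f \<in> borel_measurable (borel \<Otimes>\<^sub>M borel)"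
  shows "(\<integral>\<^sup>+s. f s \<partial>joint \<mu> 0) = (\<integral>\<^sup>+x. f (\<lambda>_. undefined, x) \<partial>\<mu>)"
proof -
  interpret R: prob_space "PiM {..<0::nat} (\<lambda>_. Q)" by (rule prob_PiM_Q)
  have [measurable_cong]: "sets \<mu> = sets borel" using assms(1) by (simp add: space_prob_algebra)
  have 0: "obs_vec h 0 p = (\<lambda>_. undefined)" for p by (simp add: obs_vec_def fun_eq_iff)
  have "(\<integral>\<^sup>+s. f s \<partial>joint \<mu> 0) = (\<integral>\<^sup>+z. \<integral>\<^sup>+p. f (\<lambda>_. undefined, p 0) \<partial>path_law T \<mu> 0 \<partial>PiM {..<0::nat} (\<lambda>_. Q))"
    using nn_integral_xz_law_obs_vec[OF assms, of 0] by (simp add: nn_integral_joint[OF assms] 0)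
  also have "\<dots> = (\<integral>\<^sup>+p. f (\<lambda>_. undefined, p 0) \<partial>path_law T \<mu> 0)"
    using R.emeasure_space_1 by simp
  also have "\<dots> = (\<integral>\<^sup>+x. f (\<lambda>_. undefined, x) \<partial>\<mu>)"
    unfolding path_law.simps by (subst nn_integral_distr) simp_all
  finally show ?thesis .
qed

lemma prior_return [simp]: "prior (return borel x)"
  by (simp add: space_prob_algebra prob_space_return)

text \<open>A point mass as prior turns a value of the backward iterate into an expectation. The
  constant function \<open>undefined\<close> is the empty history.\<close>

lemma nn_integral_joint_return:
  assumes [measurable]: "f \<in> borel_measurable (borel \<Otimes>\<^sub>M borel)"
  shows "(\<integral>\<^sup>+s. f s \<partial>joint (return borel x) k) = bwds 0 k f (\<lambda>_. undefined, x)"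
  using nn_integral_joint_add[OF prior_return assms, of x 0 k]
  by (simp add: nn_integral_joint_0 nn_integral_return)

text \<open>Time homogeneity: \<open>T\<close>, \<open>Q\<close> and \<open>h\<close> do not change
  with time, so the starting time \<open>n\<close> only decides which slots of the history receive
  the new observations, and \<open>glue\<close> accounts for that.\<close>

lemma bwds_shift:
  "bwds n k f (y, x) = bwds 0 k (\<lambda>(w, x'). f (glue n k y w, x')) (\<lambda>_. undefined, x)"
proof (induction k arbitrary: f)
  case 0
  have "glue n 0 y w = y" for w by (auto simp: glue_def fun_eq_iff)
  then show ?case by simp
next
  case (Suc k)
  have "(glue n k y w)(n + k := v) = glue n (Suc k) y (w(k := v))" for w v
    by (rule ext) (auto simp: glue_def split: if_splits)
  then have "(\<lambda>(w, x'). bwd (n + k) f (glue n k y w, x')) = bwd k (\<lambda>(w, x'). f (glue n (Suc k) y w, x'))"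
    by (simp add: bwd_def case_prod_beta)
  then show ?case
    by (simp add: Suc.IH)
qed

section \<open>Laws of observation blocks and the Markov property\<close>

definition obs_marg :: "'x measure \<Rightarrow> nat \<Rightarrow> (nat \<Rightarrow> 'y) measure" where
  "obs_marg \<mu> n = distr (xz_law T Q \<mu> n) borel (obs_vec h n)"

lemma sets_obs_marg [simp, measurable_cong]: "sets (obs_marg \<mu> n) = sets borel"
  by (simp add: obs_marg_def)

lemma space_obs_marg [simp]: "space (obs_marg \<mu> n) = UNIV"
  by (simp add: obs_marg_def)

lemma obs_vec_xz_law: "prior \<mu> \<Longrightarrow> obs_vec h n \<in> xz_law T Q \<mu> n \<rightarrow>\<^sub>M borel"
  using measurable_compose[OF measurable_obs_state measurable_fst, of \<mu> n] by simp

lemma prob_space_obs_marg: "prior \<mu> \<Longrightarrow> prob_space (obs_marg \<mu> n)"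
  unfolding obs_marg_def by (intro prob_space.prob_space_distr prob_space_xz_law obs_vec_xz_law)

lemma nn_integral_obs_marg:
  assumes "prior \<mu>" and [measurable]: "f \<in> borel_measurable borel"
  shows "(\<integral>\<^sup>+y. f y \<partial>obs_marg \<mu> n) = (\<integral>\<^sup>+s. f (fst s) \<partial>joint \<mu> n)"
  using assms(1) by (simp add: nn_integral_joint obs_marg_def nn_integral_distr obs_vec_xz_law)

lemma nn_integral_obs_marg_restrict:
  assumes "prior \<mu>" and [measurable]: "f \<in> borel_measurable borel"
  shows "(\<integral>\<^sup>+y. f (restrict y {..<n}) \<partial>obs_marg \<mu> n) = (\<integral>\<^sup>+y. f y \<partial>obs_marg \<mu> n)"
proof -
  have "restrict (obs_vec h n p) {..<n} = obs_vec h n p" for p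
    by (auto simp: obs_vec_def)
  then show ?thesis
    using assms(1) by (simp add: obs_marg_def nn_integral_distr obs_vec_xz_law)
qed

text \<open>By time homogeneity this is also the conditional law of the observations at times
  \<open>n\<close>, ..., \<open>n + k - 1\<close> given that the state at time \<open>n\<close> is
  \<open>x\<close>.\<close>

definition future :: "nat \<Rightarrow> 'x \<Rightarrow> (nat \<Rightarrow> 'y) measure" where
  "future k x = obs_marg (return borel x) k"

lemma nn_integral_future:
  assumes [measurable]: "f \<in> borel_measurable borel"
  shows "(\<integral>\<^sup>+w. f w \<partial>future k x) = bwds 0 k (\<lambda>s. f (fst s)) (\<lambda>_. undefined, x)"
  by (simp add: future_def nn_integral_obs_marg nn_integral_joint_return)

lemma measurable_future [measurable]: "future k \<in> borel \<rightarrow>\<^sub>M prob_algebra borel"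
proof (rule measurable_prob_algebraI[OF _ measurable_subprob_algebra])
  show "prob_space (future k x)" for x
    by (simp add: future_def prob_space_obs_marg)
  then show "subprob_space (future k x)" for x
    by (rule prob_space_imp_subprob_space)
  show "sets (future k x) = sets borel" for x
    by (simp add: future_def)
  fix A :: "(nat \<Rightarrow> 'y) set" assume [measurable]: "A \<in> sets borel"
  have "emeasure (future k x) A = bwds 0 k (\<lambda>s. indicator A (fst s)) (\<lambda>_. undefined, x)" for x
    using nn_integral_future[of "indicator A" k x] by (simp add: future_def)
  then show "(\<lambda>x. emeasure (future k x) A) \<in> borel_measurable borel"
    by (simp add: measurable_compose[OF measurable_Pair1' measurable_bwds])
qed

lemma measurable_future' [measurable]: "future k \<in> borel \<rightarrow>\<^sub>M subprob_algebra borel"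
  by (rule measurable_prob_algebraD[OF measurable_future])

lemma sets_future [simp, measurable_cong]: "sets (future k x) = sets borel"
  and prob_space_future: "prob_space (future k x)"
  by (simp_all add: future_def prob_space_obs_marg)

lemma nn_integral_obs_marg_add:
  assumes "prior \<mu>" and [measurable]: "f \<in> borel_measurable borel"
  shows "(\<integral>\<^sup>+y. f y \<partial>obs_marg \<mu> (n + k)) =
    (\<integral>\<^sup>+s. \<integral>\<^sup>+w. f (glue n k (fst s) w) \<partial>future k (snd s) \<partial>joint \<mu> n)"
proof -
  have "(\<integral>\<^sup>+y. f y \<partial>obs_marg \<mu> (n + k)) = (\<integral>\<^sup>+s. bwds n k (\<lambda>s. f (fst s)) s \<partial>joint \<mu> n)"
    using assms by (simp add: nn_integral_obs_marg nn_integral_joint_add)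
  also have "\<dots> = (\<integral>\<^sup>+s. \<integral>\<^sup>+w. f (glue n k (fst s) w) \<partial>future k (snd s) \<partial>joint \<mu> n)"
  proof (rule nn_integral_cong)
    fix s :: "(nat \<Rightarrow> 'y) \<times> 'x"
    have "bwds n k (\<lambda>s. f (fst s)) s = bwds 0 k (\<lambda>s'. f (glue n k (fst s) (fst s'))) (\<lambda>_. undefined, snd s)"
      using bwds_shift[of n k "\<lambda>s. f (fst s)" "fst s" "snd s"] by (simp add: case_prod_unfold)
    also have "\<dots> = (\<integral>\<^sup>+w. f (glue n k (fst s) w) \<partial>future k (snd s))"
      by (subst nn_integral_future[symmetric]) (simp_all add: measurable_compose[OF measurable_glue])
    finally show "bwds n k (\<lambda>s. f (fst s)) s = \<dots>" .
  qed
  finally show ?thesis .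
qed

text \<open>Kolmogorov consistency: events at different times can be compared under the law of the
  longest block, in place of a measure on infinite sequences.\<close>

lemma nn_integral_obs_marg_consistent:
  assumes "prior \<mu>" and [measurable]: "f \<in> borel_measurable borel"
  shows "(\<integral>\<^sup>+y. f (restrict y {..<n}) \<partial>obs_marg \<mu> (n + k)) = (\<integral>\<^sup>+y. f y \<partial>obs_marg \<mu> n)"
proof -
  have "(\<integral>\<^sup>+y. f (restrict y {..<n}) \<partial>obs_marg \<mu> (n + k)) =
    (\<integral>\<^sup>+s. \<integral>\<^sup>+w. f (restrict (fst s) {..<n}) \<partial>future k (snd s) \<partial>joint \<mu> n)"
    using assms by (simp add: nn_integral_obs_marg_add)
  also have "\<dots> = (\<integral>\<^sup>+s. f (restrict (fst s) {..<n}) \<partial>joint \<mu> n)"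
    using prob_space.emeasure_space_1[OF prob_space_future] by simp
  also have "\<dots> = (\<integral>\<^sup>+y. f (restrict y {..<n}) \<partial>obs_marg \<mu> n)"
    using assms by (simp add: nn_integral_obs_marg)
  also have "\<dots> = (\<integral>\<^sup>+y. f y \<partial>obs_marg \<mu> n)"
    using assms by (rule nn_integral_obs_marg_restrict)
  finally show ?thesis .
qed

text \<open>The prior enters the observation laws through this mixture over initial states, so
  relations between priors pass to observations of every length.\<close>

lemma emeasure_obs_marg:
  assumes "prior \<mu>" and [measurable]: "A \<in> sets borel"
  shows "emeasure (obs_marg \<mu> n) A = (\<integral>\<^sup>+x. emeasure (future n x) A \<partial>\<mu>)"
proof -
  have "emeasure (obs_marg \<mu> n) A = (\<integral>\<^sup>+y. indicator A y \<partial>obs_marg \<mu> n)"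
    by simp
  also have "\<dots> = (\<integral>\<^sup>+s. bwds 0 n (\<lambda>s. indicator A (fst s)) s \<partial>joint \<mu> 0)"
    using nn_integral_joint_add[OF assms(1), of "\<lambda>s. indicator A (fst s)" 0 n]
    by (subst nn_integral_obs_marg[OF assms(1)]) simp_all
  also have "\<dots> = (\<integral>\<^sup>+x. \<integral>\<^sup>+w. indicator A w \<partial>future n x \<partial>\<mu>)"
    by (simp add: nn_integral_joint_0[OF assms(1)] nn_integral_future del: nn_integral_indicator)
  finally show ?thesis by simp
qed

text \<open>\<open>future (Suc m)\<close> is built on a path that includes the state at time
  \<open>Suc m\<close>, while \<open>obs_law\<close> stops at time \<open>m\<close>. That last state
  enters none of the \<open>Suc m\<close> observations and integrates out because \<open>T\<close>
  is a probability kernel. The rest is a shift of indices by one.\<close>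

lemma obs_law_eq:
  "obs_law T Q h x (Suc m) = distr (future (Suc m) x) (PiM {1..Suc m} (\<lambda>_. borel)) (\<lambda>w. \<lambda>i\<in>{1..Suc m}. w (i - 1))"
proof -
  let ?P = "path_law T (return borel x)"
  let ?r = "\<lambda>w. \<lambda>i\<in>{1..Suc m}. w (i - 1) :: 'y"
  note [measurable_cong] = sets_path_law[OF prior_return, of x] sets_xz_law[OF prior_return, of x]
  interpret P: prob_space "?P m" by (rule prob_space_path_law) simp
  interpret R: prob_space "PiM {..m} (\<lambda>_. Q)" by (rule prob_PiM_Q)
  interpret PR: pair_sigma_finite "?P m" "PiM {..m} (\<lambda>_. Q)" ..
  interpret Tx: prob_space "T v" for v by (rule T_space)
  have r [measurable]: "?r \<in> borel \<rightarrow>\<^sub>M PiM {1..Suc m} (\<lambda>_. borel)"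
    by (intro measurable_restrict measurable_product_coordinate)
  have obs [measurable]: "obs_vec h (Suc m) \<in> xz_law T Q (return borel x) m \<rightarrow>\<^sub>M borel"
    by (subst measurable_cong_sets[OF sets_xz_law refl]) (auto intro: measurable_obs_vec')
  have "obs_law T Q h x (Suc m) =
      distr (xz_law T Q (return borel x) m) (PiM {1..Suc m} (\<lambda>_. borel)) (\<lambda>p. ?r (obs_vec h (Suc m) p))"
    unfolding obs_law_def by (intro distr_cong) (auto simp: obs_vec_def fun_eq_iff)
  also have "\<dots> = distr (distr (xz_law T Q (return borel x) m) borel (obs_vec h (Suc m))) (PiM {1..Suc m} (\<lambda>_. borel)) ?r"
    by (subst distr_distr) (simp_all add: comp_def)
  also have "distr (xz_law T Q (return borel x) m) borel (obs_vec h (Suc m)) = future (Suc m) x"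
  proof (rule measure_eqI)
    fix A assume "A \<in> sets (distr (xz_law T Q (return borel x) m) borel (obs_vec h (Suc m)))"
    then have A [measurable]: "A \<in> sets borel" by simp
    have upd: "obs_vec h (Suc m) (p(Suc m := x), z) = obs_vec h (Suc m) (p, z)" for p x z
      by (auto simp: obs_vec_def fun_eq_iff)
    have "emeasure (future (Suc m) x) A = (\<integral>\<^sup>+y. indicator A y \<partial>future (Suc m) x)"
      by (simp add: future_def)
    also have "\<dots> = (\<integral>\<^sup>+s. indicator A (fst s) \<partial>joint (return borel x) (Suc m))"
      unfolding future_def by (subst nn_integral_obs_marg) simp_all
    also have "\<dots> = (\<integral>\<^sup>+z. \<integral>\<^sup>+p. indicator A (obs_vec h (Suc m) (p, z)) \<partial>?P (Suc m) \<partial>PiM {..<Suc m} (\<lambda>_. Q))"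
      using nn_integral_xz_law_obs_vec[OF prior_return, of "\<lambda>s. indicator A (fst s)" x "Suc m"]
      by (subst nn_integral_joint) simp_all
    also have "\<dots> = (\<integral>\<^sup>+z. \<integral>\<^sup>+p. indicator A (obs_vec h (Suc m) (p, z)) \<partial>?P m \<partial>PiM {..<Suc m} (\<lambda>_. Q))"
    proof (rule nn_integral_cong)
      fix z assume "z \<in> space (PiM {..<Suc m} (\<lambda>_. Q))"
      then have z: "z \<in> space (PiM {..<Suc m} (\<lambda>_. borel))" by simp
      show "(\<integral>\<^sup>+p. indicator A (obs_vec h (Suc m) (p, z)) \<partial>?P (Suc m)) = (\<integral>\<^sup>+p. indicator A (obs_vec h (Suc m) (p, z)) \<partial>?P m)"
      proof -
        have "(\<lambda>p. obs_vec h (Suc m) (p, z)) \<in> PiM {..Suc m} (\<lambda>_. borel) \<rightarrow>\<^sub>M borel"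
          by (rule measurable_compose[OF measurable_Pair2'[OF z] measurable_obs_vec]) auto
        then have "(\<lambda>p. indicator A (obs_vec h (Suc m) (p, z)) :: ennreal) \<in> borel_measurable (PiM {..Suc m} (\<lambda>_. borel))"
          by measurable
        from nn_integral_path_law_Suc[OF prior_return this] show ?thesis
          by (simp add: upd Tx.emeasure_space_1[simplified])
      qed
    qed
    also have "\<dots> = (\<integral>\<^sup>+p. indicator A (obs_vec h (Suc m) p) \<partial>xz_law T Q (return borel x) m)"
      unfolding xz_law_def lessThan_Suc_atMost
      by (subst PR.nn_integral_snd[symmetric]) (use measurable_compose[OF obs[unfolded xz_law_def] borel_measurable_indicator[OF A]] in simp_all)
    also have "\<dots> = emeasure (distr (xz_law T Q (return borel x) m) borel (obs_vec h (Suc m))) A"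
      by (simp add: nn_integral_distr[symmetric] emeasure_distr nn_integral_indicator[symmetric] del: nn_integral_indicator)
    finally show "emeasure (distr (xz_law T Q (return borel x) m) borel (obs_vec h (Suc m))) A = emeasure (future (Suc m) x) A" ..
  qed simp
  finally show ?thesis .
qed

section \<open>First hitting times and the maximal inequality\<close>

abbreviation hits :: "(nat \<Rightarrow> (nat \<Rightarrow> 'y) set) \<Rightarrow> nat \<Rightarrow> (nat \<Rightarrow> 'y) set" where
  "hits D m \<equiv> {y. \<exists>k\<le>m. restrict y {..<k} \<in> D k}"

lemma sets_vimage_restrict [measurable]:
  "A \<in> sets borel \<Longrightarrow> {y :: nat \<Rightarrow> 'y. restrict y {..<k} \<in> A} \<in> sets borel"
  using measurable_sets[OF measurable_restrict_borel, of A k] by (simp add: vimage_def)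

lemma sets_hits [measurable]: "(\<And>k. D k \<in> sets borel) \<Longrightarrow> hits D m \<in> sets borel"
proof -
  assume "\<And>k. D k \<in> sets borel"
  moreover have "hits D m = (\<Union>k\<le>m. {y. restrict y {..<k} \<in> D k})" by auto
  ultimately show ?thesis by (auto intro!: sets.finite_UN sets_vimage_restrict)
qed

lemma emeasure_obs_marg_restrict:
  assumes "prior \<mu>" "A \<in> sets borel"
  shows "emeasure (obs_marg \<mu> (n + k)) {y. restrict y {..<n} \<in> A} = emeasure (obs_marg \<mu> n) A"
proof -
  have "(\<integral>\<^sup>+y. indicator A (restrict y {..<n}) \<partial>obs_marg \<mu> (n + k)) = (\<integral>\<^sup>+y. indicator A y \<partial>obs_marg \<mu> n)"
    using assms by (intro nn_integral_obs_marg_consistent) auto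
  also have "(\<integral>\<^sup>+y. indicator A (restrict y {..<n}) \<partial>obs_marg \<mu> (n + k)) =
      (\<integral>\<^sup>+y. indicator {y. restrict y {..<n} \<in> A} y \<partial>obs_marg \<mu> (n + k))"
    by (simp add: indicator_def)
  finally show ?thesis using assms by (simp add: sets_vimage_restrict)
qed

text \<open>Maximal inequality, by splitting the event according to the first \<open>k\<close> at which \<open>D k\<close> is hit.\<close>

lemma emeasure_obs_marg_hits:
  assumes \<mu>: "prior \<mu>\<^sub>1" "prior \<mu>\<^sub>2" and D: "\<And>k. D k \<in> sets borel"
    and le: "\<And>k C. C \<in> sets borel \<Longrightarrow> C \<subseteq> D k \<Longrightarrow> emeasure (obs_marg \<mu>\<^sub>1 k) C \<le> c * emeasure (obs_marg \<mu>\<^sub>2 k) C"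
  shows "emeasure (obs_marg \<mu>\<^sub>1 m) (hits D m) \<le> c * emeasure (obs_marg \<mu>\<^sub>2 m) (hits D m)"
proof (induction m)
  have restr: "emeasure (obs_marg \<mu> m) {y. restrict y {..<m} \<in> A} = emeasure (obs_marg \<mu> m) A"
    if "prior \<mu>" "A \<in> sets borel" for \<mu> m A
    using emeasure_obs_marg_restrict[OF that, of m 0] by simp
  {
    case 0
    have 0: "hits D 0 = {y. restrict y {..<0} \<in> D 0}" by auto
    show ?case
      unfolding 0 restr[OF \<mu>(1) D] restr[OF \<mu>(2) D] by (rule le[OF D]) simp
  next
    case (Suc m)
    \<comment> \<open>Together with the truncation below, these are the histories that hit first at
      time \<open>Suc m\<close>. The set is a proper part of \<open>D (Suc m)\<close> in general,
      which is why \<open>le\<close> is assumed for all measurable subsets.\<close>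
    let ?C = "D (Suc m) - hits D m"
    have C: "?C \<in> sets borel" using D by auto
    \<comment> \<open>Membership in \<open>hits D m\<close> depends on the first \<open>m\<close>
      coordinates only, so by consistency the law at time \<open>Suc m\<close> may be replaced by
      the one at time \<open>m\<close>.\<close>
    have hit: "restrict y {..<k} \<in> hits D m \<longleftrightarrow> y \<in> hits D m" if "m \<le> k" for y k
    proof -
      have "restrict (restrict y {..<k}) {..<j} = restrict y {..<j}" if "j \<le> m" for j
        using that \<open>m \<le> k\<close> by (auto simp: fun_eq_iff)
      then show ?thesis by auto
    qed
    have split: "hits D (Suc m) = {y. restrict y {..<m} \<in> hits D m} \<union> {y. restrict y {..<Suc m} \<in> ?C}"
      using hit[of m] hit[of "Suc m"] by (auto simp: le_Suc_eq)
    have disj: "{y. restrict y {..<m} \<in> hits D m} \<inter> {y. restrict y {..<Suc m} \<in> ?C} = {}"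
      using hit[of m] hit[of "Suc m"] by auto
    have eq: "emeasure (obs_marg \<mu> (Suc m)) (hits D (Suc m)) =
        emeasure (obs_marg \<mu> m) (hits D m) + emeasure (obs_marg \<mu> (Suc m)) ?C" if "prior \<mu>" for \<mu>
    proof -
      have "emeasure (obs_marg \<mu> (Suc m)) (hits D (Suc m)) =
          emeasure (obs_marg \<mu> (Suc m)) {y. restrict y {..<m} \<in> hits D m} +
          emeasure (obs_marg \<mu> (Suc m)) {y. restrict y {..<Suc m} \<in> ?C}"
        unfolding split by (rule plus_emeasure[symmetric])
          (use D C disj in \<open>auto simp: sets_vimage_restrict simp del: mem_Collect_eq\<close>)
      then show ?thesis
        using emeasure_obs_marg_restrict[OF that, of "hits D m" m 1] restr[OF that C, of "Suc m"] D by simp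
    qed
    show ?case
      unfolding eq[OF \<mu>(1)] eq[OF \<mu>(2)] distrib_left
      by (intro add_mono Suc.IH le C) auto
  }
qed

section \<open>Predictors as disintegrations, and forecasts\<close>

lemma measurable_predictor:
  assumes "is_predictor T Q h \<mu> n \<kappa>"
  shows "(\<lambda>y. \<kappa> (restrict y {..<n})) \<in> borel \<rightarrow>\<^sub>M prob_algebra borel"
  using assms by (auto simp: is_predictor_def intro: measurable_compose[OF measurable_restrict_PiM])

text \<open>The definition of a predictor settles rectangles. These generate the product and are
  stable under intersection, so the whole joint law disintegrates along the history.\<close>

lemma nn_integral_joint_predictor:
  assumes \<mu>: "prior \<mu>" and pred: "is_predictor T Q h \<mu> n \<kappa>"
    and F [measurable]: "F \<in> borel_measurable (borel \<Otimes>\<^sub>M borel)"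
  shows "(\<integral>\<^sup>+s. F s \<partial>joint \<mu> n) = (\<integral>\<^sup>+y. \<integral>\<^sup>+x. F (y, x) \<partial>\<kappa> (restrict y {..<n}) \<partial>obs_marg \<mu> n)"
proof -
  define \<kappa>' where "\<kappa>' y = \<kappa> (restrict y {..<n})" for y
  have \<kappa>' [measurable]: "\<kappa>' \<in> borel \<rightarrow>\<^sub>M prob_algebra borel"
    unfolding \<kappa>'_def using pred by (rule measurable_predictor)
  have \<kappa>'_sp: "sets (\<kappa>' y) = sets borel" "prob_space (\<kappa>' y)" for y
    using measurable_space[OF \<kappa>', of y] by (auto simp: space_prob_algebra)
  interpret J: prob_space "joint \<mu> n" by (rule prob_space_joint[OF \<mu>])
  interpret X: prob_space "xz_law T Q \<mu> n" by (rule prob_space_xz_law[OF \<mu>])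
  \<comment> \<open>The predictor paired with a point mass at the history, so that
    \<open>obs_marg \<mu> n \<bind> K\<close> is the candidate for the joint law.\<close>
  define K where "K y = distr (\<kappa>' y) (borel \<Otimes>\<^sub>M borel) (\<lambda>x. (y, x))" for y
  have K [measurable]: "K \<in> borel \<rightarrow>\<^sub>M prob_algebra (borel \<Otimes>\<^sub>M borel)"
    unfolding K_def by measurable
  have K' [measurable]: "K \<in> obs_marg \<mu> n \<rightarrow>\<^sub>M subprob_algebra (borel \<Otimes>\<^sub>M borel)"
    using measurable_prob_algebraD[OF K] by (simp cong: measurable_cong_sets)
  have obs: "obs_vec h n p \<in> space (PiM {..<n} (\<lambda>_. borel))" for p
    by (auto simp: space_PiM obs_vec_def)
  have restr: "restrict (obs_vec h n p) {..<n} = obs_vec h n p" for p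
    by (auto simp: obs_vec_def)
  have "joint \<mu> n = obs_marg \<mu> n \<bind> K"
  proof (rule measure_eqI_generator_eq[OF Int_stable_pair_measure_generator pair_measure_closed])
    show "sets (joint \<mu> n) = sigma_sets (space borel \<times> space borel) {a \<times> b |a b. a \<in> sets borel \<and> b \<in> sets borel}"
      by (simp add: sets_pair_measure)
    show "sets (obs_marg \<mu> n \<bind> K) = sigma_sets (space borel \<times> space borel) {a \<times> b |a b. a \<in> sets borel \<and> b \<in> sets borel}"
      by (subst sets_bind[where N = "borel \<Otimes>\<^sub>M borel"]) (simp_all add: K_def sets_pair_measure)
    show "range (\<lambda>_::nat. UNIV :: ((nat \<Rightarrow> 'y) \<times> 'x) set) \<subseteq> {a \<times> b |a b. a \<in> sets borel \<and> b \<in> sets borel}"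
      by (auto intro!: exI[of _ UNIV])
    fix S assume "S \<in> {a \<times> b |a b. a \<in> sets (borel :: (nat \<Rightarrow> 'y) measure) \<and> b \<in> sets (borel :: 'x measure)}"
    then obtain B A where S: "S = B \<times> A" and B [measurable]: "B \<in> sets (borel :: (nat \<Rightarrow> 'y) measure)"
      and A [measurable]: "A \<in> sets (borel :: 'x measure)" by auto
    \<comment> \<open>\<open>is_predictor\<close> tests with sets of \<open>PiM {..<n}\<close>, so
      the Borel set is cut down to functions that are \<open>undefined\<close> from \<open>n\<close>
      on; every observation vector is of this kind.\<close>
    define B' where "B' = B \<inter> space (PiM {..<n} (\<lambda>_. borel))"
    have B': "B' \<in> sets (PiM {..<n} (\<lambda>_. borel))"
      using measurable_sets[OF measurable_id_PiM_borel B] by (simp add: B'_def)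
    have f: "(\<lambda>p. indicator B (obs_vec h n p) * measure (\<kappa>' (obs_vec h n p)) A) \<in> borel_measurable (xz_law T Q \<mu> n)"
      using measurable_compose[OF obs_vec_xz_law[OF \<mu>], of "\<lambda>y. indicator B y * measure (\<kappa>' y) A" borel n] by simp
    have m1: "indicator B y * measure (\<kappa>' y) A \<le> 1" for y
      using prob_space.prob_le_1[OF \<kappa>'_sp(2)] by (auto split: split_indicator)
    have "emeasure (joint \<mu> n) (B \<times> A) = emeasure (xz_law T Q \<mu> n) {p \<in> space (xz_law T Q \<mu> n). fst p n \<in> A \<and> obs_vec h n p \<in> B'}"
      unfolding joint_def by (subst emeasure_distr[OF measurable_obs_state[OF \<mu>]])
        (auto intro!: arg_cong[where f = "emeasure _"] simp: B'_def obs)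
    also have "\<dots> = ennreal (\<integral>p. indicator B' (obs_vec h n p) * measure (\<kappa> (obs_vec h n p)) A \<partial>xz_law T Q \<mu> n)"
      using pred A B' unfolding is_predictor_def X.emeasure_eq_measure by simp
    also have "\<dots> = ennreal (\<integral>p. indicator B (obs_vec h n p) * measure (\<kappa>' (obs_vec h n p)) A \<partial>xz_law T Q \<mu> n)"
      by (simp add: \<kappa>'_def restr B'_def obs indicator_inter_arith indicator_def)
    also have "\<dots> = (\<integral>\<^sup>+p. ennreal (indicator B (obs_vec h n p) * measure (\<kappa>' (obs_vec h n p)) A) \<partial>xz_law T Q \<mu> n)"
      using f m1 by (intro nn_integral_eq_integral[symmetric] X.integrable_const_bound[where B = 1]) auto
    also have "\<dots> = (\<integral>\<^sup>+y. ennreal (indicator B y * measure (\<kappa>' y) A) \<partial>obs_marg \<mu> n)"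
      unfolding obs_marg_def by (subst nn_integral_distr[OF obs_vec_xz_law[OF \<mu>]]) simp_all
    also have "\<dots> = (\<integral>\<^sup>+y. emeasure (K y) (B \<times> A) \<partial>obs_marg \<mu> n)"
    proof (rule nn_integral_cong)
      fix y
      have "emeasure (K y) (B \<times> A) = emeasure (\<kappa>' y) ((\<lambda>x. (y, x)) -` (B \<times> A) \<inter> space (\<kappa>' y))"
        unfolding K_def by (intro emeasure_distr) (auto simp: \<kappa>'_sp cong: measurable_cong_sets)
      also have "(\<lambda>x. (y, x)) -` (B \<times> A) \<inter> space (\<kappa>' y) = (if y \<in> B then A else {})"
        using sets_eq_imp_space_eq[OF \<kappa>'_sp(1)] by auto
      finally show "ennreal (indicator B y * measure (\<kappa>' y) A) = emeasure (K y) (B \<times> A)"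
        using \<kappa>'_sp(2)[of y] by (simp add: finite_measure.emeasure_eq_measure prob_space_def)
    qed
    also have "\<dots> = emeasure (obs_marg \<mu> n \<bind> K) (B \<times> A)"
      by (rule emeasure_bind[symmetric, OF _ K']) auto
    finally show "emeasure (joint \<mu> n) S = emeasure (obs_marg \<mu> n \<bind> K) S" unfolding S .
  qed auto
  then have "(\<integral>\<^sup>+s. F s \<partial>joint \<mu> n) = (\<integral>\<^sup>+y. \<integral>\<^sup>+s. F s \<partial>K y \<partial>obs_marg \<mu> n)"
    by (simp add: nn_integral_bind[OF F K'])
  also have "\<dots> = (\<integral>\<^sup>+y. \<integral>\<^sup>+x. F (y, x) \<partial>\<kappa>' y \<partial>obs_marg \<mu> n)"
    unfolding K_def by (intro nn_integral_cong nn_integral_distr) (auto simp: \<kappa>'_sp cong: measurable_cong_sets)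
  finally show ?thesis by (simp add: \<kappa>'_def)
qed

text \<open>For a predictor \<open>\<kappa>\<close>: the conditional law of the \<open>N\<close> observations following the first \<open>n\<close>.\<close>

definition forecast :: "((nat \<Rightarrow> 'y) \<Rightarrow> 'x measure) \<Rightarrow> nat \<Rightarrow> nat \<Rightarrow> (nat \<Rightarrow> 'y) \<Rightarrow> (nat \<Rightarrow> 'y) measure" where
  "forecast \<kappa> n N y = \<kappa> (restrict y {..<n}) \<bind> future N"

lemma measurable_forecast:
  assumes "is_predictor T Q h \<mu> n \<kappa>"
  shows "forecast \<kappa> n N \<in> borel \<rightarrow>\<^sub>M prob_algebra borel"
  unfolding forecast_def
  by (rule measurable_bind_prob_space[OF measurable_predictor[OF assms] measurable_future])

text \<open>The Markov property gives the next observations from the state at time \<open>n\<close>,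
  and the predictor gives that state from the history; composing both kernels yields
  \<open>forecast\<close>.\<close>

lemma nn_integral_obs_marg_forecast:
  assumes \<mu>: "prior \<mu>" and pred: "is_predictor T Q h \<mu> n \<kappa>"
    and F [measurable]: "F \<in> borel_measurable (borel \<Otimes>\<^sub>M borel)"
  shows "(\<integral>\<^sup>+y. F (restrict y {..<n}, shift n N y) \<partial>obs_marg \<mu> (n + N)) =
    (\<integral>\<^sup>+y. \<integral>\<^sup>+w. F (y, w) \<partial>forecast \<kappa> n N y \<partial>obs_marg \<mu> n)"
proof -
  note \<kappa> [measurable] = measurable_predictor[OF pred]
  note [measurable] = measurable_prob_algebraD[OF \<kappa>]
  have \<kappa>_sp: "sets (\<kappa> (restrict y {..<n})) = sets borel" for y
    using measurable_space[OF \<kappa>, of y] by (auto simp: space_prob_algebra)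
  have fut: "(\<lambda>s. \<integral>\<^sup>+w. F (fst s, w) \<partial>future N (snd s)) \<in> borel_measurable (borel \<Otimes>\<^sub>M borel)"
    by (rule nn_integral_measurable_subprob_algebra2[where N = borel]) measurable
  define \<Psi> where "\<Psi> y = (\<integral>\<^sup>+x. \<integral>\<^sup>+w. F (y, w) \<partial>future N x \<partial>\<kappa> (restrict y {..<n}))" for y
  have \<Psi>: "\<Psi> \<in> borel_measurable borel"
    unfolding \<Psi>_def using fut
    by (intro nn_integral_measurable_subprob_algebra2[where N = borel]) (simp_all add: case_prod_beta)
  have rr: "restrict (restrict y {..<n}) {..<n} = restrict y {..<n}" for y :: "nat \<Rightarrow> 'y" by auto
  have "(\<integral>\<^sup>+y. F (restrict y {..<n}, shift n N y) \<partial>obs_marg \<mu> (n + N)) =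
    (\<integral>\<^sup>+s. \<integral>\<^sup>+w. F (restrict (fst s) {..<n}, restrict w {..<N}) \<partial>future N (snd s) \<partial>joint \<mu> n)"
    by (subst nn_integral_obs_marg_add[OF \<mu>]) (simp_all add: shift_glue)
  also have "\<dots> = (\<integral>\<^sup>+s. \<integral>\<^sup>+w. F (restrict (fst s) {..<n}, w) \<partial>future N (snd s) \<partial>joint \<mu> n)"
    unfolding future_def by (intro nn_integral_cong nn_integral_obs_marg_restrict[OF prior_return]) simp
  also have "\<dots> = (\<integral>\<^sup>+y. \<Psi> (restrict y {..<n}) \<partial>obs_marg \<mu> n)"
    unfolding \<Psi>_def rr
    using measurable_compose[of "\<lambda>s. (restrict (fst s) {..<n}, snd s)" "borel \<Otimes>\<^sub>M borel", OF _ fut]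
    by (subst nn_integral_joint_predictor[OF \<mu> pred]) simp_all
  also have "\<dots> = (\<integral>\<^sup>+y. \<Psi> y \<partial>obs_marg \<mu> n)"
    by (rule nn_integral_obs_marg_restrict[OF \<mu> \<Psi>])
  also have "\<dots> = (\<integral>\<^sup>+y. \<integral>\<^sup>+w. F (y, w) \<partial>forecast \<kappa> n N y \<partial>obs_marg \<mu> n)"
    unfolding \<Psi>_def forecast_def
    by (intro nn_integral_cong nn_integral_bind[symmetric, where B = borel])
      (simp_all add: \<kappa>_sp cong: measurable_cong_sets)
  finally show ?thesis .
qed

end

section \<open>Likelihood ratios and merging\<close>

locale pomp_pair = pomp T Q h
  for T :: "'x::polish_space \<Rightarrow> 'x measure" and Q :: "'z::polish_space measure"
    and h :: "'x \<times> 'z \<Rightarrow> 'y::polish_space" +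
  fixes \<mu> \<nu> :: "'x measure" and \<kappa>\<mu> \<kappa>\<nu> :: "nat \<Rightarrow> (nat \<Rightarrow> 'y) \<Rightarrow> 'x measure"
  assumes \<mu>: "prior \<mu>" and \<nu>: "prior \<nu>" and ac: "absolutely_continuous \<nu> \<mu>"
    and pred\<mu>: "\<And>n. is_predictor T Q h \<mu> n (\<kappa>\<mu> n)"
    and pred\<nu>: "\<And>n. is_predictor T Q h \<nu> n (\<kappa>\<nu> n)"
begin

lemma prior_sets: "sets \<mu> = sets borel" "sets \<nu> = sets borel" "prob_space \<mu>" "prob_space \<nu>"
  using \<mu> \<nu> by (auto simp: space_prob_algebra)

lemma measurable_emeasure_future:
  "A \<in> sets borel \<Longrightarrow> (\<lambda>x. emeasure (future n x) A) \<in> borel_measurable borel"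
  by (rule measurable_compose[OF measurable_future' measurable_emeasure_subprob_algebra])

text \<open>By the mixture formula, an event that is null under \<nu> has probability zero given
  \<nu>-almost every initial state, hence given \<mu>-almost every one.\<close>

lemma absolutely_continuous_obs_marg: "absolutely_continuous (obs_marg \<nu> n) (obs_marg \<mu> n)"
  unfolding absolutely_continuous_def
proof (rule subsetI)
  fix A assume "A \<in> null_sets (obs_marg \<nu> n)"
  then have A: "A \<in> sets borel" and "emeasure (obs_marg \<nu> n) A = 0" by auto
  note [measurable] = measurable_emeasure_future[OF A, of n]
  note [measurable_cong] = prior_sets(1,2)
  have "AE x in \<nu>. emeasure (future n x) A = 0"
    using \<open>emeasure (obs_marg \<nu> n) A = 0\<close> unfolding emeasure_obs_marg[OF \<nu> A]
    by (subst (asm) nn_integral_0_iff_AE) simp_all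
  then have "AE x in \<mu>. emeasure (future n x) A = 0"
    by (rule absolutely_continuous_AE[OF _ ac, rotated]) (simp add: prior_sets)
  then have "emeasure (obs_marg \<mu> n) A = 0"
    unfolding emeasure_obs_marg[OF \<mu> A] by (subst nn_integral_0_iff_AE) simp_all
  then show "A \<in> null_sets (obs_marg \<mu> n)" using A by auto
qed

text \<open>A Radon-Nikodym derivative is determined only almost everywhere. Composing it with the
  truncation gives a version that depends on the first \<open>n\<close> coordinates at every point,
  and it is still a density because the laws do not see the truncation.\<close>

lemma ex_likelihood_ratio:
  "\<exists>l :: (nat \<Rightarrow> 'y) \<Rightarrow> real. l \<in> borel_measurable borel \<and> (\<forall>y. 0 \<le> l y) \<and> (\<forall>y. l (restrict y {..<n}) = l y) \<and>
    obs_marg \<mu> n = density (obs_marg \<nu> n) (\<lambda>y. ennreal (l y))"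
proof -
  interpret N: prob_space "obs_marg \<nu> n" by (rule prob_space_obs_marg[OF \<nu>])
  interpret M: prob_space "obs_marg \<mu> n" by (rule prob_space_obs_marg[OF \<mu>])
  have sets_eq: "sets (obs_marg \<mu> n) = sets (obs_marg \<nu> n)" by simp
  obtain D where D: "D \<in> borel_measurable (obs_marg \<nu> n)"
    and RN: "AE y in obs_marg \<nu> n. RN_deriv (obs_marg \<nu> n) (obs_marg \<mu> n) y = ennreal (D y)"
    and D0: "\<And>y. 0 \<le> D y"
    using N.real_RN_deriv[OF M.finite_measure_axioms absolutely_continuous_obs_marg sets_eq] by blast
  have [measurable]: "D \<in> borel_measurable borel" using D by (simp cong: measurable_cong_sets)
  define l where "l y = D (restrict y {..<n})" for y
  have [measurable]: "l \<in> borel_measurable borel" unfolding l_def by measurable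
  have rr: "restrict (restrict y {..<n}) {..<n} = restrict y {..<n}" for y :: "nat \<Rightarrow> 'y" by auto
  have "obs_marg \<mu> n = density (obs_marg \<nu> n) (\<lambda>y. ennreal (l y))"
  proof (rule measure_eqI)
    fix A assume "A \<in> sets (obs_marg \<mu> n)"
    then have A [measurable]: "A \<in> sets borel" by simp
    have "emeasure (obs_marg \<mu> n) A = (\<integral>\<^sup>+y. indicator A y \<partial>obs_marg \<mu> n)" by simp
    also have "\<dots> = (\<integral>\<^sup>+y. ennreal (D y) * indicator A y \<partial>obs_marg \<nu> n)"
      using RN by (subst N.RN_deriv_nn_integral[OF absolutely_continuous_obs_marg sets_eq])
        (auto intro!: nn_integral_cong_AE)
    also have "\<dots> = (\<integral>\<^sup>+y. ennreal (D (restrict y {..<n})) * indicator A (restrict y {..<n}) \<partial>obs_marg \<nu> n)"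
      by (rule nn_integral_obs_marg_restrict[OF \<nu>, symmetric]) simp
    also have "\<dots> = (\<integral>\<^sup>+y. ennreal (l y) * indicator A y \<partial>obs_marg \<nu> n)"
      using nn_integral_obs_marg_restrict[OF \<nu>, of "\<lambda>y. ennreal (l y) * indicator A y" n]
      by (simp only: l_def rr) simp
    also have "\<dots> = emeasure (density (obs_marg \<nu> n) (\<lambda>y. ennreal (l y))) A"
      by (rule emeasure_density[symmetric]) simp_all
    finally show "emeasure (obs_marg \<mu> n) A = \<dots>" .
  qed simp
  then show ?thesis
    using D0 by (intro exI[of _ l]) (auto simp: l_def rr)
qed

definition LR :: "nat \<Rightarrow> (nat \<Rightarrow> 'y) \<Rightarrow> real" where
  "LR n = (SOME l. l \<in> borel_measurable borel \<and> (\<forall>y. 0 \<le> l y) \<and> (\<forall>y. l (restrict y {..<n}) = l y) \<and>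
    obs_marg \<mu> n = density (obs_marg \<nu> n) (\<lambda>y. ennreal (l y)))"

lemma measurable_LR [measurable]: "LR n \<in> borel_measurable borel"
  and LR_nonneg: "0 \<le> LR n y"
  and LR_restrict: "LR n (restrict y {..<n}) = LR n y"
  and obs_marg_density: "obs_marg \<mu> n = density (obs_marg \<nu> n) (\<lambda>y. ennreal (LR n y))"
  using someI_ex[OF ex_likelihood_ratio[of n], folded LR_def] by blast+

lemma nn_integral_LR:
  assumes [measurable]: "f \<in> borel_measurable borel"
  shows "(\<integral>\<^sup>+y. f y \<partial>obs_marg \<mu> n) = (\<integral>\<^sup>+y. ennreal (LR n y) * f y \<partial>obs_marg \<nu> n)"
  unfolding obs_marg_density by (rule nn_integral_density) simp_all

lemma emeasure_LR:
  assumes [measurable]: "A \<in> sets borel"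
  shows "emeasure (obs_marg \<mu> n) A = (\<integral>\<^sup>+y. ennreal (LR n y) * indicator A y \<partial>obs_marg \<nu> n)"
  unfolding obs_marg_density by (rule emeasure_density) simp_all

lemma emeasure_hits_LR_small:
  assumes "0 \<le> \<delta>"
  shows "emeasure (obs_marg \<mu> m) (hits (\<lambda>k. {y. LR k y < \<delta>}) m) \<le> ennreal \<delta>"
proof -
  interpret N: prob_space "obs_marg \<nu> m" by (rule prob_space_obs_marg[OF \<nu>])
  have "emeasure (obs_marg \<mu> m) (hits (\<lambda>k. {y. LR k y < \<delta>}) m) \<le>
    ennreal \<delta> * emeasure (obs_marg \<nu> m) (hits (\<lambda>k. {y. LR k y < \<delta>}) m)"
  proof (rule emeasure_obs_marg_hits[OF \<mu> \<nu>])
    fix k C assume C: "C \<in> sets borel" "C \<subseteq> {y. LR k y < \<delta>}"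
    then have "emeasure (obs_marg \<mu> k) C \<le> (\<integral>\<^sup>+y. ennreal \<delta> * indicator C y \<partial>obs_marg \<nu> k)"
      unfolding emeasure_LR[OF C(1)]
      by (intro nn_integral_mono) (auto split: split_indicator intro!: ennreal_leI)
    then show "emeasure (obs_marg \<mu> k) C \<le> ennreal \<delta> * emeasure (obs_marg \<nu> k) C"
      using C(1) by (simp add: nn_integral_cmult_indicator)
  qed simp
  also have "\<dots> \<le> ennreal \<delta> * 1"
    by (intro mult_left_mono N.emeasure_le_1) simp
  finally show ?thesis by simp
qed

text \<open>The priors exchange roles: where the ratio exceeds \<open>b\<close>, the \<nu>-law is at
  most \<open>1 / b\<close> times the \<mu>-law. The resulting bound is one under \<nu>.\<close>

lemma emeasure_hits_LR_large:
  assumes "0 < b"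
  shows "emeasure (obs_marg \<nu> m) (hits (\<lambda>k. {y. b < LR k y}) m) \<le> ennreal (1 / b)"
proof -
  interpret M: prob_space "obs_marg \<mu> m" by (rule prob_space_obs_marg[OF \<mu>])
  have "emeasure (obs_marg \<nu> m) (hits (\<lambda>k. {y. b < LR k y}) m) \<le>
    ennreal (1 / b) * emeasure (obs_marg \<mu> m) (hits (\<lambda>k. {y. b < LR k y}) m)"
  proof (rule emeasure_obs_marg_hits[OF \<nu> \<mu>])
    fix k C assume C: "C \<in> sets borel" "C \<subseteq> {y. b < LR k y}"
    have "emeasure (obs_marg \<nu> k) C = (\<integral>\<^sup>+y. indicator C y \<partial>obs_marg \<nu> k)"
      using C by simp
    also have "\<dots> \<le> (\<integral>\<^sup>+y. ennreal (1 / b) * (ennreal (LR k y) * indicator C y) \<partial>obs_marg \<nu> k)"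
      using C(2) assms LR_nonneg by (intro nn_integral_mono)
        (auto simp: ennreal_mult''[symmetric] subset_eq less_imp_le split: split_indicator)
    also have "\<dots> = ennreal (1 / b) * emeasure (obs_marg \<mu> k) C"
      unfolding emeasure_LR[OF C(1)] using C(1) by (intro nn_integral_cmult) simp
    finally show "emeasure (obs_marg \<nu> k) C \<le> ennreal (1 / b) * emeasure (obs_marg \<mu> k) C" .
  qed simp
  also have "\<dots> \<le> ennreal (1 / b) * 1"
    by (intro mult_left_mono M.emeasure_le_1) simp
  finally show ?thesis by simp
qed

text \<open>The conditional drift of \<open>1 / (1 + LR n)\<close> over \<open>N\<close> steps under \<open>\<nu>\<close>.\<close>

definition gap :: "nat \<Rightarrow> nat \<Rightarrow> (nat \<Rightarrow> 'y) \<Rightarrow> real" where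
  "gap N n y = (\<integral>w. 1 / (1 + LR (n + N) (glue n N y w)) \<partial>forecast (\<kappa>\<nu> n) n N y) - 1 / (1 + LR n y)"

lemma forecast_sp:
  "sets (forecast (\<kappa>\<mu> n) n N y) = sets borel" "prob_space (forecast (\<kappa>\<mu> n) n N y)"
  "sets (forecast (\<kappa>\<nu> n) n N y) = sets borel" "prob_space (forecast (\<kappa>\<nu> n) n N y)"
  using measurable_space[OF measurable_forecast[OF pred\<mu>], of y n N]
    measurable_space[OF measurable_forecast[OF pred\<nu>], of y n N]
  by (auto simp: space_prob_algebra)

lemma measurable_LR_glue:
  "(\<lambda>(y, w). LR (n + N) (glue n N y w)) \<in> borel_measurable (borel \<Otimes>\<^sub>M borel)"
  by (simp add: case_prod_beta measurable_compose[OF measurable_glue measurable_LR])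

lemma LR_glue_measurable: "(\<lambda>w. LR (n + N) (glue n N y w)) \<in> borel_measurable (forecast (\<kappa>\<nu> n) n N y)"
  using measurable_compose[OF measurable_Pair1' measurable_LR_glue, of y n N]
  by (simp add: forecast_sp cong: measurable_cong_sets)

lemma measurable_gap [measurable]: "gap N n \<in> borel_measurable borel"
proof -
  note [measurable] = measurable_LR_glue[of n N] measurable_prob_algebraD[OF measurable_forecast[OF pred\<nu>], of n N]
  have "(\<integral>w. 1 / (1 + LR (n + N) (glue n N y w)) \<partial>forecast (\<kappa>\<nu> n) n N y) =
      enn2real (\<integral>\<^sup>+w. ennreal (1 / (1 + LR (n + N) (glue n N y w))) \<partial>forecast (\<kappa>\<nu> n) n N y)" for y
    using LR_glue_measurable[of n N y] by (intro integral_eq_nn_integral) (auto simp: LR_nonneg add_nonneg_nonneg)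
  moreover have "(\<lambda>y. \<integral>\<^sup>+w. ennreal (1 / (1 + LR (n + N) (glue n N y w))) \<partial>forecast (\<kappa>\<nu> n) n N y) \<in> borel_measurable borel"
    by (rule nn_integral_measurable_subprob_algebra2[where N = borel])
      (simp_all add: case_prod_beta measurable_compose[OF measurable_glue measurable_LR])
  ultimately have "(\<lambda>y. \<integral>w. 1 / (1 + LR (n + N) (glue n N y w)) \<partial>forecast (\<kappa>\<nu> n) n N y) \<in> borel_measurable borel"
    by simp
  then show ?thesis unfolding gap_def by measurable
qed

text \<open>Both sides of \<open>eq\<close> are the \<mu>-probability that the first
  \<open>n\<close> observations lie in \<open>B\<close> and the next \<open>N\<close> in
  \<open>A\<close>. One side conditions under \<mu> and changes measure at time \<open>n\<close>;
  the other changes measure at time \<open>n + N\<close> and conditions under \<nu>.\<close>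

lemma AE_forecast_density:
  shows "AE y in obs_marg \<nu> n. (\<integral>\<^sup>+w. ennreal (LR (n + N) (glue n N y w)) \<partial>forecast (\<kappa>\<nu> n) n N y) = ennreal (LR n y)"
    and "AE y in obs_marg \<nu> n. 0 < LR n y \<longrightarrow> forecast (\<kappa>\<mu> n) n N y =
      density (forecast (\<kappa>\<nu> n) n N y) (\<lambda>w. ennreal (LR (n + N) (glue n N y w) / LR n y))"
proof -
  interpret N: prob_space "obs_marg \<nu> n" by (rule prob_space_obs_marg[OF \<nu>])
  have m1: "forecast (\<kappa>\<mu> n) n N \<in> obs_marg \<nu> n \<rightarrow>\<^sub>M prob_algebra borel"
    and m2: "forecast (\<kappa>\<nu> n) n N \<in> obs_marg \<nu> n \<rightarrow>\<^sub>M prob_algebra borel"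
    using measurable_forecast[OF pred\<mu>] measurable_forecast[OF pred\<nu>] by (simp_all cong: measurable_cong_sets)
  have m3: "(\<lambda>(y, w). LR (n + N) (glue n N y w)) \<in> borel_measurable (obs_marg \<nu> n \<Otimes>\<^sub>M borel)"
    using measurable_LR_glue by measurable
  have eq: "(\<integral>\<^sup>+y. indicator B y * (\<integral>\<^sup>+w. indicator A w \<partial>forecast (\<kappa>\<mu> n) n N y) * ennreal (LR n y) \<partial>obs_marg \<nu> n) =
      (\<integral>\<^sup>+y. \<integral>\<^sup>+w. indicator B y * indicator A w * ennreal (LR (n + N) (glue n N y w)) \<partial>forecast (\<kappa>\<nu> n) n N y \<partial>obs_marg \<nu> n)"
    if A [measurable]: "A \<in> sets borel" and "B \<in> sets (obs_marg \<nu> n)" for A B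
  proof -
    have B [measurable]: "B \<in> sets borel" using that by simp
    note [measurable] = measurable_prob_algebraD[OF measurable_forecast[OF pred\<mu>], of n N]
    have LR_sh: "LR (n + N) (glue n N (restrict y {..<n}) (shift n N y)) = LR (n + N) y" for y
      unfolding glue_shift by (rule LR_restrict)
    have mG: "(\<lambda>y. \<integral>\<^sup>+w. indicator A w \<partial>forecast (\<kappa>\<mu> n) n N y) \<in> borel_measurable borel"
      by measurable
    have "(\<integral>\<^sup>+y. indicator B y * (\<integral>\<^sup>+w. indicator A w \<partial>forecast (\<kappa>\<mu> n) n N y) * ennreal (LR n y) \<partial>obs_marg \<nu> n) =
        (\<integral>\<^sup>+y. indicator B y * (\<integral>\<^sup>+w. indicator A w \<partial>forecast (\<kappa>\<mu> n) n N y) \<partial>obs_marg \<mu> n)"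
      using mG by (subst nn_integral_LR) (simp_all add: mult_ac)
    also have "\<dots> = (\<integral>\<^sup>+y. \<integral>\<^sup>+w. indicator B y * indicator A w \<partial>forecast (\<kappa>\<mu> n) n N y \<partial>obs_marg \<mu> n)"
      by (intro nn_integral_cong nn_integral_cmult[symmetric]) (simp add: forecast_sp cong: measurable_cong_sets)
    also have "\<dots> = (\<integral>\<^sup>+y. indicator B (restrict y {..<n}) * indicator A (shift n N y) \<partial>obs_marg \<mu> (n + N))"
      using nn_integral_obs_marg_forecast[OF \<mu> pred\<mu>, of "\<lambda>(y, w). indicator B y * indicator A w" n N] by simp
    also have "\<dots> = (\<integral>\<^sup>+y. ennreal (LR (n + N) y) * (indicator B (restrict y {..<n}) * indicator A (shift n N y)) \<partial>obs_marg \<nu> (n + N))"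
      by (intro nn_integral_LR) measurable
    also have "\<dots> = (\<integral>\<^sup>+y. \<integral>\<^sup>+w. indicator B y * indicator A w * ennreal (LR (n + N) (glue n N y w)) \<partial>forecast (\<kappa>\<nu> n) n N y \<partial>obs_marg \<nu> n)"
      using nn_integral_obs_marg_forecast[OF \<nu> pred\<nu>,
          of "\<lambda>(y, w). indicator B y * indicator A w * ennreal (LR (n + N) (glue n N y w))" n N] measurable_LR_glue[of n N]
      by (simp add: LR_sh mult_ac case_prod_beta)
    finally show ?thesis .
  qed
  show "AE y in obs_marg \<nu> n. (\<integral>\<^sup>+w. ennreal (LR (n + N) (glue n N y w)) \<partial>forecast (\<kappa>\<nu> n) n N y) = ennreal (LR n y)"
    and "AE y in obs_marg \<nu> n. 0 < LR n y \<longrightarrow> forecast (\<kappa>\<mu> n) n N y =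
      density (forecast (\<kappa>\<nu> n) n N y) (\<lambda>w. ennreal (LR (n + N) (glue n N y w) / LR n y))"
    by (rule AE_kernel_eq_density[OF N.finite_measure_axioms m1 m2 _ LR_nonneg m3 LR_nonneg eq], simp, assumption, simp)+
qed

lemma AE_gap_nonneg: "AE y in obs_marg \<nu> n. 0 \<le> gap N n y"
  using AE_forecast_density(1)[of n N]
proof eventually_elim
  case (elim y)
  show ?case
    unfolding gap_def
    by (rule reciprocal_gap_nonneg[OF forecast_sp(4) LR_glue_measurable LR_nonneg LR_nonneg elim])
qed

text \<open>The tower property under \<nu>. As \<open>ennreal\<close> truncates negative numbers,
  replacing the difference in \<open>gap\<close> by a sum rests on
  \<open>AE_gap_nonneg\<close>.\<close>

lemma nn_integral_gap:
  "(\<integral>\<^sup>+y. ennreal (gap N n y) \<partial>obs_marg \<nu> n) + (\<integral>\<^sup>+y. ennreal (1 / (1 + LR n y)) \<partial>obs_marg \<nu> n) =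
    (\<integral>\<^sup>+y. ennreal (1 / (1 + LR (n + N) y)) \<partial>obs_marg \<nu> (n + N))"
proof -
  have LR_sh: "LR (n + N) (glue n N (restrict y {..<n}) (shift n N y)) = LR (n + N) y" for y
    unfolding glue_shift by (rule LR_restrict)
  have "(\<integral>\<^sup>+y. ennreal (gap N n y) \<partial>obs_marg \<nu> n) + (\<integral>\<^sup>+y. ennreal (1 / (1 + LR n y)) \<partial>obs_marg \<nu> n) =
    (\<integral>\<^sup>+y. ennreal (gap N n y) + ennreal (1 / (1 + LR n y)) \<partial>obs_marg \<nu> n)"
    by (rule nn_integral_add[symmetric]) measurable
  also have "\<dots> = (\<integral>\<^sup>+y. \<integral>\<^sup>+w. ennreal (1 / (1 + LR (n + N) (glue n N y w))) \<partial>forecast (\<kappa>\<nu> n) n N y \<partial>obs_marg \<nu> n)"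
  proof (rule nn_integral_cong_AE)
    show "AE y in obs_marg \<nu> n. ennreal (gap N n y) + ennreal (1 / (1 + LR n y)) =
      (\<integral>\<^sup>+w. ennreal (1 / (1 + LR (n + N) (glue n N y w))) \<partial>forecast (\<kappa>\<nu> n) n N y)"
      using AE_gap_nonneg[of N n] AE_forecast_density(1)[of n N]
    proof eventually_elim
      case (elim y)
      have "ennreal (gap N n y) + ennreal (1 / (1 + LR n y)) = ennreal (\<integral>w. 1 / (1 + LR (n + N) (glue n N y w)) \<partial>forecast (\<kappa>\<nu> n) n N y)"
        using elim(1) LR_nonneg[of n y] by (subst ennreal_plus[symmetric]) (auto simp: gap_def)
      also have "\<dots> = (\<integral>\<^sup>+w. ennreal (1 / (1 + LR (n + N) (glue n N y w))) \<partial>forecast (\<kappa>\<nu> n) n N y)"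
        using integrable_reciprocal[OF forecast_sp(4) LR_glue_measurable LR_nonneg LR_nonneg elim(2)]
        by (intro nn_integral_eq_integral[symmetric]) (auto simp: LR_nonneg add_nonneg_nonneg)
      finally show ?case .
    qed
  qed
  also have "\<dots> = (\<integral>\<^sup>+y. ennreal (1 / (1 + LR (n + N) y)) \<partial>obs_marg \<nu> (n + N))"
    using nn_integral_obs_marg_forecast[OF \<nu> pred\<nu>,
        of "\<lambda>(y, w). ennreal (1 / (1 + LR (n + N) (glue n N y w)))" n N] measurable_LR_glue[of n N]
    by (simp add: LR_sh case_prod_beta)
  finally show ?thesis .
qed

end

section \<open>Almost sure statements on a space carrying the process under \<mu>\<close>

locale pomp_observed = pomp_pair T Q h \<mu> \<nu> \<kappa>\<mu> \<kappa>\<nu> + prob_space M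
  for T :: "'x::polish_space \<Rightarrow> 'x measure" and Q :: "'z::polish_space measure"
    and h :: "'x \<times> 'z \<Rightarrow> 'y::polish_space"
    and \<mu> \<nu> :: "'x measure" and \<kappa>\<mu> \<kappa>\<nu> :: "nat \<Rightarrow> (nat \<Rightarrow> 'y) \<Rightarrow> 'x measure" and M :: "'w measure" +
  fixes Y :: "nat \<Rightarrow> 'w \<Rightarrow> nat \<Rightarrow> 'y"
  assumes Y [measurable]: "\<And>n. Y n \<in> M \<rightarrow>\<^sub>M borel"
    and Y_law: "\<And>n. distr M borel (Y n) = obs_marg \<mu> n"
    and Y_restrict: "\<And>k n \<omega>. k \<le> n \<Longrightarrow> restrict (Y n \<omega>) {..<k} = Y k \<omega>"
begin

lemma AE_Y:
  assumes "AE y in obs_marg \<nu> n. P y"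
  shows "AE \<omega> in M. P (Y n \<omega>)"
proof -
  have "AE y in obs_marg \<mu> n. P y"
    by (rule absolutely_continuous_AE[OF _ absolutely_continuous_obs_marg assms]) simp
  then show ?thesis
    unfolding Y_law[symmetric] by (rule AE_distrD[OF Y])
qed

text \<open>For fixed \<open>j\<close> the hitting events increase with \<open>m\<close>, so a bound
  uniform in \<open>m\<close> survives the limit. Paths that hit at every level \<open>j\<close>
  therefore have probability below every \<open>e\<close>.\<close>

lemma AE_eventually_avoids:
  assumes D [measurable]: "\<And>(j :: nat) (k :: nat). D j k \<in> sets borel"
    and small: "\<And>e. 0 < e \<Longrightarrow> \<exists>j. \<forall>m. emeasure (obs_marg \<mu> m) (hits (D j) m) \<le> ennreal e"
  shows "AE \<omega> in M. \<exists>j. \<forall>k. Y k \<omega> \<notin> D j k"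
proof -
  define H where "H j m = {\<omega> \<in> space M. \<exists>k\<le>m. Y k \<omega> \<in> D j k}" for j m
  have H_eq: "H j m = Y m -` hits (D j) m \<inter> space M" for j m
    unfolding H_def using Y_restrict by auto
  have H [measurable]: "H j m \<in> sets M" for j m
    unfolding H_eq by (intro measurable_sets[OF Y] sets_hits D)
  have H_le: "emeasure M (H j m) = emeasure (obs_marg \<mu> m) (hits (D j) m)" for j m
    unfolding H_eq Y_law[symmetric] by (intro emeasure_distr[symmetric] Y) (simp add: sets_hits D)
  define B where "B = (\<Inter>j. \<Union>m. H j m)"
  have B: "B \<in> sets M"
    unfolding B_def by measurable
  have B_le: "emeasure M B \<le> ennreal e" if e: "0 < e" for e
  proof -
    obtain j where j: "\<And>m. emeasure (obs_marg \<mu> m) (hits (D j) m) \<le> ennreal e"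
      using small[OF e] by blast
    have "emeasure M B \<le> emeasure M (\<Union>m. H j m)"
      unfolding B_def by (intro emeasure_mono) auto
    also have "\<dots> = (SUP m. emeasure M (H j m))"
      by (intro SUP_emeasure_incseq[symmetric]) (auto simp: incseq_def H_def intro: order_trans)
    also have "\<dots> \<le> ennreal e"
      unfolding H_le by (intro SUP_least j)
    finally show ?thesis .
  qed
  have "emeasure M B \<le> 0"
    by (rule ennreal_le_epsilon) (simp only: add_0 B_le)
  then have "B \<in> null_sets M" using B by (intro null_setsI) simp_all
  moreover have "{\<omega> \<in> space M. \<not> (\<exists>j. \<forall>k. Y k \<omega> \<notin> D j k)} \<subseteq> B"
    unfolding B_def H_def by blast
  ultimately show ?thesis by (rule AE_I')
qed

lemma AE_LR_bounded_below: "AE \<omega> in M. \<exists>a>0. \<forall>n. a \<le> LR n (Y n \<omega>)"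
proof -
  have "AE \<omega> in M. \<exists>j. \<forall>k. Y k \<omega> \<notin> {y. LR k y < 1 / real (Suc j)}"
  proof (rule AE_eventually_avoids)
    fix e :: real assume "0 < e"
    then obtain j where "1 / real (Suc j) < e" using nat_approx_posE by blast
    then have "emeasure (obs_marg \<mu> m) (hits (\<lambda>k. {y. LR k y < 1 / real (Suc j)}) m) \<le> ennreal e" for m
      by (intro order_trans[OF emeasure_hits_LR_small ennreal_leI]) auto
    then show "\<exists>j. \<forall>m. emeasure (obs_marg \<mu> m) (hits (\<lambda>k. {y. LR k y < 1 / real (Suc j)}) m) \<le> ennreal e"
      by blast
  qed measurable
  then show ?thesis
  proof eventually_elim
    case (elim \<omega>)
    then obtain j where "\<forall>k. Y k \<omega> \<notin> {y. LR k y < 1 / real (Suc j)}" by blast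
    then show ?case by (intro exI[of _ "1 / real (Suc j)"]) (auto simp: not_less)
  qed
qed

text \<open>The maximal inequality controls a large ratio under \<nu>. In \<open>unif\<close> the
  function \<open>a\<close> is the probability of the hitting event given the initial state, and
  \<open>d\<close> is fixed before the horizon \<open>m\<close>.\<close>

lemma AE_LR_bounded_above: "AE \<omega> in M. \<exists>b. \<forall>n. LR n (Y n \<omega>) \<le> b"
proof -
  have "AE \<omega> in M. \<exists>j. \<forall>k. Y k \<omega> \<notin> {y. real (Suc j) < LR k y}"
  proof (rule AE_eventually_avoids)
    fix e :: real assume "0 < e"
    with absolutely_continuous_uniform[OF prior_sets(4,3) _ ac this] prior_sets
    obtain d :: real where d: "0 < d"
      and unif: "\<And>a. a \<in> borel_measurable \<nu> \<Longrightarrow> (\<And>x. a x \<le> (1 :: ennreal)) \<Longrightarrow>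
        (\<integral>\<^sup>+x. a x \<partial>\<nu>) \<le> ennreal d \<Longrightarrow> (\<integral>\<^sup>+x. a x \<partial>\<mu>) \<le> ennreal e"
      by metis
    obtain j where j: "1 / real (Suc j) < d" using d nat_approx_posE by blast
    let ?H = "\<lambda>m. hits (\<lambda>k. {y. real (Suc j) < LR k y}) m"
    have "emeasure (obs_marg \<mu> m) (?H m) \<le> ennreal e" for m
    proof -
      have H: "?H m \<in> sets borel" by (intro sets_hits) measurable
      have "emeasure (obs_marg \<nu> m) (?H m) \<le> ennreal (1 / real (Suc j))"
        by (rule emeasure_hits_LR_large) simp
      also have "\<dots> \<le> ennreal d" using j by (intro ennreal_leI) simp
      finally show ?thesis
        unfolding emeasure_obs_marg[OF \<nu> H] emeasure_obs_marg[OF \<mu> H]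
        using measurable_emeasure_future[OF H, of m] prior_sets
        by (intro unif) (auto intro!: prob_space.emeasure_le_1 prob_space_future cong: measurable_cong_sets)
    qed
    then show "\<exists>j. \<forall>m. emeasure (obs_marg \<mu> m) (hits (\<lambda>k. {y. real (Suc j) < LR k y}) m) \<le> ennreal e"
      by blast
  qed measurable
  then show ?thesis
  proof eventually_elim
    case (elim \<omega>)
    then obtain j where "\<forall>k. Y k \<omega> \<notin> {y. real (Suc j) < LR k y}" by blast
    then show ?case by (intro exI[of _ "real (Suc j)"]) (auto simp: not_less)
  qed
qed

text \<open>The \<mu>-means of the quotients are at most the \<nu>-means of \<open>gap N n\<close>,
  whose sum is at most \<open>N\<close> by telescoping. Hence the series of the quotients converges
  almost surely.\<close>

lemma AE_gap_tendsto_0: "AE \<omega> in M. (\<lambda>n. gap N n (Y n \<omega>) / (1 + LR n (Y n \<omega>))) \<longlonglongrightarrow> 0"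
proof -
  define W where "W n y = gap N n y / (1 + LR n y)" for n y
  have W [measurable]: "W n \<in> borel_measurable borel" for n
    unfolding W_def by measurable
  have "(\<Sum>n. \<integral>\<^sup>+\<omega>. ennreal (W n (Y n \<omega>)) \<partial>M) \<le> of_nat N"
  proof (rule suminf_le_of_telescoping)
    fix n
    interpret N: prob_space "obs_marg \<nu> n" by (rule prob_space_obs_marg[OF \<nu>])
    have "(\<integral>\<^sup>+\<omega>. ennreal (W n (Y n \<omega>)) \<partial>M) = (\<integral>\<^sup>+y. ennreal (W n y) \<partial>obs_marg \<mu> n)"
      unfolding Y_law[symmetric] by (rule nn_integral_distr[symmetric]) simp_all
    also have "\<dots> = (\<integral>\<^sup>+y. ennreal (LR n y) * ennreal (W n y) \<partial>obs_marg \<nu> n)"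
      by (rule nn_integral_LR) simp
    also have "\<dots> \<le> (\<integral>\<^sup>+y. ennreal (gap N n y) \<partial>obs_marg \<nu> n)"
    proof (rule nn_integral_mono_AE)
      show "AE y in obs_marg \<nu> n. ennreal (LR n y) * ennreal (W n y) \<le> ennreal (gap N n y)"
        using AE_gap_nonneg[of N n]
      proof eventually_elim
        case (elim y)
        have "LR n y * (gap N n y / (1 + LR n y)) \<le> gap N n y"
          using mult_left_mono[of "LR n y / (1 + LR n y)" 1 "gap N n y"] elim LR_nonneg[of n y]
          by (simp add: divide_le_eq add_nonneg_pos mult.commute)
        then show ?case
          using LR_nonneg[of n y] by (simp add: W_def ennreal_mult'[symmetric] ennreal_leI)
      qed
    qed
    finally show "(\<integral>\<^sup>+\<omega>. ennreal (W n (Y n \<omega>)) \<partial>M) + (\<integral>\<^sup>+y. ennreal (1 / (1 + LR n y)) \<partial>obs_marg \<nu> n) \<le>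
        (\<integral>\<^sup>+y. ennreal (1 / (1 + LR (n + N) y)) \<partial>obs_marg \<nu> (n + N))"
      unfolding nn_integral_gap[symmetric] by (rule add_right_mono)
    have "(\<integral>\<^sup>+y. ennreal (1 / (1 + LR n y)) \<partial>obs_marg \<nu> n) \<le> (\<integral>\<^sup>+y. 1 \<partial>obs_marg \<nu> n)"
      using LR_nonneg by (intro nn_integral_mono) (simp add: divide_le_eq add_pos_nonneg)
    then show "(\<integral>\<^sup>+y. ennreal (1 / (1 + LR n y)) \<partial>obs_marg \<nu> n) \<le> 1"
      using N.emeasure_space_1 by simp
  qed
  then have "(\<integral>\<^sup>+\<omega>. (\<Sum>n. ennreal (W n (Y n \<omega>))) \<partial>M) \<le> of_nat N"
    by (subst nn_integral_suminf) simp_all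
  then have "(\<integral>\<^sup>+\<omega>. (\<Sum>n. ennreal (W n (Y n \<omega>))) \<partial>M) \<noteq> \<infinity>"
    using of_nat_less_top[of N] by (auto simp: top_unique)
  then have "AE \<omega> in M. (\<Sum>n. ennreal (W n (Y n \<omega>))) \<noteq> \<infinity>"
    by (intro nn_integral_PInf_AE) simp_all
  \<comment> \<open>A finite \<open>ennreal\<close> sum says nothing about negative terms, so they
    are excluded separately.\<close>
  moreover have "AE \<omega> in M. \<forall>n. 0 \<le> gap N n (Y n \<omega>)"
    by (subst AE_all_countable) (intro allI AE_Y AE_gap_nonneg)
  ultimately show ?thesis
  proof eventually_elim
    case (elim \<omega>)
    have "summable (\<lambda>n. W n (Y n \<omega>))"
      using elim LR_nonneg by (intro summable_suminf_not_top) (auto simp: W_def)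
    then show ?case
      unfolding W_def by (rule summable_LIMSEQ_zero)
  qed
qed

text \<open>The almost sure event is the same for all bounded \<open>g\<close>: the forecasts merge in total variation.\<close>

lemma AE_forecast_merge:
  "AE \<omega> in M. \<forall>g :: (nat \<Rightarrow> 'y) \<Rightarrow> real. g \<in> borel_measurable borel \<and> bounded (range g) \<longrightarrow>
    (\<lambda>n. (\<integral>w. g w \<partial>forecast (\<kappa>\<mu> n) n N (Y n \<omega>)) - (\<integral>w. g w \<partial>forecast (\<kappa>\<nu> n) n N (Y n \<omega>))) \<longlonglongrightarrow> 0"
proof -
  have "AE \<omega> in M. \<forall>n. (\<integral>\<^sup>+w. ennreal (LR (n + N) (glue n N (Y n \<omega>) w)) \<partial>forecast (\<kappa>\<nu> n) n N (Y n \<omega>)) = ennreal (LR n (Y n \<omega>))"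
    by (subst AE_all_countable) (intro allI AE_Y[OF AE_forecast_density(1)])
  moreover have "AE \<omega> in M. \<forall>n. 0 < LR n (Y n \<omega>) \<longrightarrow> forecast (\<kappa>\<mu> n) n N (Y n \<omega>) =
      density (forecast (\<kappa>\<nu> n) n N (Y n \<omega>)) (\<lambda>w. ennreal (LR (n + N) (glue n N (Y n \<omega>) w) / LR n (Y n \<omega>)))"
    by (subst AE_all_countable) (intro allI AE_Y[OF AE_forecast_density(2)])
  moreover note AE_gap_tendsto_0[of N] AE_LR_bounded_below AE_LR_bounded_above
  ultimately show ?thesis
  proof eventually_elim
    case (elim \<omega>)
    obtain a b where a: "0 < a" "\<And>n. a \<le> LR n (Y n \<omega>)" and b: "\<And>n. LR n (Y n \<omega>) \<le> b"
      using elim(4,5) by blast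
    have pos: "0 < LR n (Y n \<omega>)" for n using a(1) a(2)[of n] by linarith
    show ?case
    proof (intro allI impI, elim conjE)
      fix g :: "(nat \<Rightarrow> 'y) \<Rightarrow> real" assume g: "g \<in> borel_measurable borel" "bounded (range g)"
      then obtain c where c: "\<And>w. \<bar>g w\<bar> \<le> c" by (auto simp: bounded_iff)
      then have c0: "0 \<le> c" using order_trans[OF abs_ge_zero c] by blast
      show "(\<lambda>n. (\<integral>w. g w \<partial>forecast (\<kappa>\<mu> n) n N (Y n \<omega>)) - (\<integral>w. g w \<partial>forecast (\<kappa>\<nu> n) n N (Y n \<omega>))) \<longlonglongrightarrow> 0"
      proof (rule tendsto_zero_of_reciprocal_gap[OF elim(3) _ a b c0])
        show "0 \<le> gap N n (Y n \<omega>)" for n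
          unfolding gap_def
          by (rule reciprocal_gap_nonneg[OF forecast_sp(4) LR_glue_measurable LR_nonneg LR_nonneg]) (use elim(1) in blast)
        \<comment> \<open>With the countably many identities valid at \<omega>, the estimate is
          available for every \<open>g\<close> and \<open>t\<close>; only the constant
          \<open>c\<close> depends on \<open>g\<close>.\<close>
        show "\<bar>(\<integral>w. g w \<partial>forecast (\<kappa>\<mu> n) n N (Y n \<omega>)) - (\<integral>w. g w \<partial>forecast (\<kappa>\<nu> n) n N (Y n \<omega>))\<bar>
            \<le> c / LR n (Y n \<omega>) * (t / 2 * (1 + LR n (Y n \<omega>)) + (1 + LR n (Y n \<omega>))\<^sup>2 * gap N n (Y n \<omega>) / (2 * t))"
          if "0 < t" for n t
          unfolding gap_def elim(2)[rule_format, OF pos]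
          by (rule integral_diff_le_reciprocal_gap[OF forecast_sp(4) LR_glue_measurable LR_nonneg LR_nonneg _ pos that _ c])
            (use elim(1) g(1) in \<open>auto simp: forecast_sp cong: measurable_cong_sets\<close>)
      qed
    qed
  qed
qed

section \<open>From observations back to the state\<close>

lemma obs_law_approx:
  fixes f :: "'x \<Rightarrow> real"
  assumes obs: "N_step_observable T Q h (Suc m)" and f: "continuous_on UNIV f" "bounded (range f)" and e: "0 < e"
  obtains g :: "(nat \<Rightarrow> 'y) \<Rightarrow> real" where "g \<in> borel_measurable borel" "bounded (range g)"
    "\<And>x. \<bar>f x - (\<integral>w. g w \<partial>future (Suc m) x)\<bar> \<le> e"
proof -
  let ?P = "PiM {1..Suc m} (\<lambda>_. borel :: 'y measure)"
  let ?r = "\<lambda>w. \<lambda>i\<in>{1..Suc m}. w (i - 1) :: 'y"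
  obtain g where g: "g \<in> borel_measurable ?P" "bounded (g ` space ?P)"
    and sup: "(SUP x. \<bar>f x - (\<integral>y. g y \<partial>obs_law T Q h x (Suc m))\<bar>) < e"
    using obs f e unfolding N_step_observable_def by blast
  have r [measurable]: "?r \<in> borel \<rightarrow>\<^sub>M ?P"
    by (intro measurable_restrict measurable_product_coordinate)
  obtain c where c: "\<And>y. y \<in> space ?P \<Longrightarrow> \<bar>g y\<bar> \<le> c" using g(2) by (auto simp: bounded_iff)
  obtain c' where c': "\<And>x. \<bar>f x\<bar> \<le> c'" using f(2) by (auto simp: bounded_iff)
  have r_sp: "?r w \<in> space ?P" for w by (auto simp: space_PiM)
  have c0: "0 \<le> c" using order_trans[OF abs_ge_zero c[OF r_sp]] by blast
  have eq: "(\<integral>y. g y \<partial>obs_law T Q h x (Suc m)) = (\<integral>w. g (?r w) \<partial>future (Suc m) x)" for x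
    unfolding obs_law_eq by (rule integral_distr) (use g r in \<open>simp_all cong: measurable_cong_sets\<close>)
  have g_le: "\<bar>\<integral>w. g (?r w) \<partial>future (Suc m) x\<bar> \<le> c" for x
  proof -
    interpret F: prob_space "future (Suc m) x" by (rule prob_space_future)
    have "\<bar>\<integral>w. g (?r w) \<partial>future (Suc m) x\<bar> \<le> (\<integral>w. c \<partial>future (Suc m) x)"
      using measurable_compose[OF r g(1)] c[OF r_sp] c0
      by (intro order_trans[OF integral_abs_bound integral_mono] F.integrable_const_bound[where B = c])
        (auto cong: measurable_cong_sets)
    then show ?thesis by (simp add: F.prob_space)
  qed
  \<comment> \<open>A real supremum is known to dominate the individual values only when the set is
    bounded above, so this comes before \<open>sup\<close> is used pointwise.\<close>
  have bdd: "bdd_above (range (\<lambda>x. \<bar>f x - (\<integral>w. g (?r w) \<partial>future (Suc m) x)\<bar>))"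
  proof (rule bdd_aboveI2)
    show "\<bar>f x - (\<integral>w. g (?r w) \<partial>future (Suc m) x)\<bar> \<le> c' + c" for x
      using c'[of x] g_le[of x] by linarith
  qed
  show ?thesis
  proof (rule that)
    show "(\<lambda>w. g (?r w)) \<in> borel_measurable borel" by (rule measurable_compose[OF r g(1)])
    show "bounded (range (\<lambda>w. g (?r w)))" using c[OF r_sp] by (auto simp: bounded_iff)
    show "\<bar>f x - (\<integral>w. g (?r w) \<partial>future (Suc m) x)\<bar> \<le> e" for x
      using cSUP_upper[OF UNIV_I bdd, of x] sup unfolding eq by linarith
  qed
qed

text \<open>\<open>K\<close> will be a predictor; then \<open>K \<bind> future N\<close> is its
  forecast, and the integral of \<open>f\<close> is expressed up to \<open>e\<close> through
  observations.\<close>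

lemma integral_forecast_approx:
  fixes f :: "'x \<Rightarrow> real" and g :: "(nat \<Rightarrow> 'y) \<Rightarrow> real"
  assumes f: "f \<in> borel_measurable borel" "bounded (range f)" and g: "g \<in> borel_measurable borel" "bounded (range g)"
    and le: "\<And>x. \<bar>f x - (\<integral>w. g w \<partial>future N x)\<bar> \<le> e"
    and K: "K \<in> space (prob_algebra borel)"
  shows "\<bar>(\<integral>x. f x \<partial>K) - (\<integral>w. g w \<partial>(K \<bind> future N))\<bar> \<le> e"
proof -
  interpret K: prob_space K using K by (simp add: space_prob_algebra)
  have [measurable_cong]: "sets K = sets borel" using K by (simp add: space_prob_algebra)
  note [measurable] = f(1) g(1)
  obtain c where c: "\<And>w. \<bar>g w\<bar> \<le> c" using g(2) by (auto simp: bounded_iff)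
  obtain c' where c': "\<And>x. \<bar>f x\<bar> \<le> c'" using f(2) by (auto simp: bounded_iff)
  have fut [measurable]: "(\<lambda>x. \<integral>w. g w \<partial>future N x) \<in> borel_measurable borel"
    by measurable
  have g_le: "\<bar>\<integral>w. g w \<partial>future N x\<bar> \<le> c' + e" for x
    using le[of x] c'[of x] by linarith
  have "(\<integral>w. g w \<partial>(K \<bind> future N)) = (\<integral>x. \<integral>w. g w \<partial>future N x \<partial>K)"
    by (rule integral_bind[where K = borel and B = c and B' = 1])
      (use c prob_space.emeasure_space_1[OF prob_space_future] in \<open>auto intro: K.finite_measure_axioms\<close>)
  moreover have f_int: "integrable K f" and g_int: "integrable K (\<lambda>x. \<integral>w. g w \<partial>future N x)"
    using K.integrable_const_bound[of f c'] K.integrable_const_bound[of "\<lambda>x. \<integral>w. g w \<partial>future N x" "c' + e"] c' g_le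
    by simp_all
  ultimately have eq: "(\<integral>x. f x \<partial>K) - (\<integral>w. g w \<partial>(K \<bind> future N)) = (\<integral>x. f x - (\<integral>w. g w \<partial>future N x) \<partial>K)"
    by simp
  have "\<bar>\<integral>x. f x - (\<integral>w. g w \<partial>future N x) \<partial>K\<bar> \<le> (\<integral>x. e \<partial>K)"
    using f_int g_int le by (intro order_trans[OF integral_abs_bound integral_mono]) auto
  then show ?thesis unfolding eq by (simp add: K.prob_space)
qed

lemma AE_predictors_merge:
  assumes "observable T Q h"
  shows "AE \<omega> in M. \<forall>f :: 'x \<Rightarrow> real. continuous_on UNIV f \<and> bounded (range f) \<longrightarrow>
    (\<lambda>n. \<bar>(\<integral>x. f x \<partial>\<kappa>\<mu> n (Y n \<omega>)) - (\<integral>x. f x \<partial>\<kappa>\<nu> n (Y n \<omega>))\<bar>) \<longlonglongrightarrow> 0"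
proof -
  obtain m where obs: "N_step_observable T Q h (Suc m)"
    using assms unfolding observable_def by (metis gr0_conv_Suc)
  show ?thesis
    using AE_forecast_merge[of "Suc m"]
  proof eventually_elim
    case (elim \<omega>)
    show ?case
    proof (intro allI impI, elim conjE)
      fix f :: "'x \<Rightarrow> real" assume f: "continuous_on UNIV f" "bounded (range f)"
      then have f_meas: "f \<in> borel_measurable borel" by (intro borel_measurable_continuous_onI)
      let ?d = "\<lambda>n. (\<integral>x. f x \<partial>\<kappa>\<mu> n (Y n \<omega>)) - (\<integral>x. f x \<partial>\<kappa>\<nu> n (Y n \<omega>))"
      show "(\<lambda>n. \<bar>?d n\<bar>) \<longlonglongrightarrow> 0"
      proof (rule tendstoI)
        fix e :: real assume "0 < e"
        \<comment> \<open>One third each for the approximation of \<open>f\<close> under the two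
          predictors and for the difference of the forecasts of \<open>g\<close>.\<close>
        then obtain g :: "(nat \<Rightarrow> 'y) \<Rightarrow> real" where g: "g \<in> borel_measurable borel" "bounded (range g)"
          and le: "\<And>x. \<bar>f x - (\<integral>w. g w \<partial>future (Suc m) x)\<bar> \<le> e / 3"
          using obs_law_approx[OF obs f, of "e / 3"] by auto
        let ?g = "\<lambda>n. (\<integral>w. g w \<partial>forecast (\<kappa>\<mu> n) n (Suc m) (Y n \<omega>)) - (\<integral>w. g w \<partial>forecast (\<kappa>\<nu> n) n (Suc m) (Y n \<omega>))"
        have "?g \<longlonglongrightarrow> 0" using elim g by blast
        then have "eventually (\<lambda>n. dist (?g n) 0 < e / 3) sequentially"
          using \<open>0 < e\<close> by (intro tendstoD) auto
        then show "eventually (\<lambda>n. dist \<bar>?d n\<bar> 0 < e) sequentially"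
        proof eventually_elim
          case (elim n)
          have Yn: "restrict (Y n \<omega>) {..<n} = Y n \<omega>" by (rule Y_restrict) simp
          have K: "\<kappa>\<mu> n (Y n \<omega>) \<in> space (prob_algebra borel)" "\<kappa>\<nu> n (Y n \<omega>) \<in> space (prob_algebra borel)"
            using measurable_space[OF measurable_predictor[OF pred\<mu>], of "Y n \<omega>" n]
              measurable_space[OF measurable_predictor[OF pred\<nu>], of "Y n \<omega>" n] by (simp_all add: Yn)
          show ?case
            using elim integral_forecast_approx[OF f_meas f(2) g le K(1)]
              integral_forecast_approx[OF f_meas f(2) g le K(2)]
            unfolding forecast_def Yn dist_real_def by linarith
        qed
      qed
    qed
  qed
qed

end

theorem theorem1:
  fixes T :: "'x::polish_space \<Rightarrow> 'x measure"
    and Q :: "'z::polish_space measure"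
    and h :: "'x \<times> 'z \<Rightarrow> 'y::polish_space"
    and \<mu> \<nu> :: "'x measure"
    and M :: "'w measure"
    and X :: "nat \<Rightarrow> 'w \<Rightarrow> 'x" and Z :: "nat \<Rightarrow> 'w \<Rightarrow> 'z"
    and \<kappa>\<mu> \<kappa>\<nu> :: "nat \<Rightarrow> (nat \<Rightarrow> 'y) \<Rightarrow> 'x measure"
  assumes T: "T \<in> borel \<rightarrow>\<^sub>M prob_algebra borel"
    and Q: "prob_space Q" "sets Q = sets borel"
    and h: "h \<in> borel_measurable borel"
    and \<mu>: "prob_space \<mu>" "sets \<mu> = sets borel"
    and \<nu>: "prob_space \<nu>" "sets \<nu> = sets borel"
    and ac: "absolutely_continuous \<nu> \<mu>"
    and obs: "observable T Q h"
    and M: "prob_space M"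
    and X: "\<And>i. X i \<in> M \<rightarrow>\<^sub>M borel" and Z: "\<And>i. Z i \<in> M \<rightarrow>\<^sub>M borel"
    and law: "\<And>n. distr M (PiM {..n} (\<lambda>_. borel) \<Otimes>\<^sub>M PiM {..n} (\<lambda>_. borel))
                 (\<lambda>\<omega>. (\<lambda>i\<in>{..n}. X i \<omega>, \<lambda>i\<in>{..n}. Z i \<omega>)) = xz_law T Q \<mu> n"
    and pred\<mu>: "\<And>n. is_predictor T Q h \<mu> n (\<kappa>\<mu> n)"
    and pred\<nu>: "\<And>n. is_predictor T Q h \<nu> n (\<kappa>\<nu> n)"
  shows "AE \<omega> in M. \<forall>f :: 'x \<Rightarrow> real. continuous_on UNIV f \<and> bounded (range f) \<longrightarrow>
           (\<lambda>n. \<bar>(\<integral>x. f x \<partial>\<kappa>\<mu> n (\<lambda>i\<in>{..<n}. h (X i \<omega>, Z i \<omega>)))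
                - (\<integral>x. f x \<partial>\<kappa>\<nu> n (\<lambda>i\<in>{..<n}. h (X i \<omega>, Z i \<omega>)))\<bar>) \<longlonglongrightarrow> 0"
proof -
  interpret pomp_pair T Q h \<mu> \<nu> \<kappa>\<mu> \<kappa>\<nu>
  proof (intro pomp_pair.intro pomp.intro pomp_pair_axioms.intro)
    show "\<mu> \<in> space (prob_algebra borel)" "\<nu> \<in> space (prob_algebra borel)"
      using \<mu> \<nu> by (simp_all add: space_prob_algebra)
  qed (fact T Q h ac pred\<mu> pred\<nu>)+
  let ?Y = "\<lambda>n \<omega>. \<lambda>i\<in>{..<n}. h (X i \<omega>, Z i \<omega>)"
  let ?W = "\<lambda>n \<omega>. (\<lambda>i\<in>{..n}. X i \<omega>, \<lambda>i\<in>{..n}. Z i \<omega>)"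
  have W: "?W n \<in> M \<rightarrow>\<^sub>M PiM {..n} (\<lambda>_. borel) \<Otimes>\<^sub>M PiM {..n} (\<lambda>_. borel)" for n
    by (intro measurable_Pair measurable_restrict X Z)
  \<comment> \<open>This writes the history as a function of the block whose law is prescribed by
    \<open>law\<close>, so that its own law is \<open>obs_marg \<mu> n\<close>.\<close>
  have Y_eq: "?Y n = (\<lambda>\<omega>. obs_vec h n (?W n \<omega>))" for n
    by (auto simp: obs_vec_def fun_eq_iff)
  have obs_vec: "obs_vec h n \<in> PiM {..n} (\<lambda>_. borel) \<Otimes>\<^sub>M PiM {..n} (\<lambda>_. borel) \<rightarrow>\<^sub>M borel" for n
    by (rule measurable_obs_vec') simp
  interpret pomp_observed T Q h \<mu> \<nu> \<kappa>\<mu> \<kappa>\<nu> M ?Y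
  proof (intro pomp_observed.intro pomp_observed_axioms.intro)
    show "pomp_pair T Q h \<mu> \<nu> \<kappa>\<mu> \<kappa>\<nu>" by unfold_locales
    show "prob_space M" by fact
    show "?Y n \<in> M \<rightarrow>\<^sub>M borel" for n
      unfolding Y_eq by (rule measurable_compose[OF W obs_vec])
    show "distr M borel (?Y n) = obs_marg \<mu> n" for n
      unfolding obs_marg_def law[symmetric] Y_eq
      by (subst distr_distr[OF obs_vec W]) (simp add: comp_def)
    show "restrict (?Y n \<omega>) {..<k} = ?Y k \<omega>" if "k \<le> n" for k n \<omega>
      using that by (auto simp: fun_eq_iff)
  qed
  show ?thesis using obs by (rule AE_predictors_merge)
qed

end
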